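(* Let $(T,f)$ be a minimal Hubbard tree (with periodic critical point) with kneading sequence $\nu$, and let $z\in\,]c_0,c_1[$ be a characteristic point of period $n$ with itinerary $\tau$. Then there is a characteristic point $z'\in\,]z,c_1]$ closest to $z$ (i.e. $]z,z'[$ contains no characteristic point). Moreover, either $z'\in\,]z,c_1[$ and $z'$ has itinerary $B_Q(\tau)$, or $z'=c_1$ and $\nu=\mathcal{A}^{-1}_{Qn}(\tau)$, where $Q$ is the period of the local arm at $z$ that points to $c_1$.
   Context: Conventions: $f^{\circ n}$ is the $n$-th iterate; $\mathrm{orb}(x)=\{f^{\circ n}(x):n\ge 0\}$; periods are exact; $\overline{w}$ is the infinite repetition of the word $w$. A tree is a connected compact metric space that is a finite union of arcs and contains no simple closed curve. Endpoints, inner points, branch points are points whose complement has one, two, more than two components. $[x,y]$ is the unique closed arc joining $x,y$; $]x,y[$, $]x,y]$, $[x,y[$ omit the corresponding endpoints. A Hubbard tree $(T,f)$ is a tree $T$ with a continuous surjective map $f:T\to T$ and a critical point $c_0\in T$ such that: (a) $f$ is at most 2-to-1; (b) $f$ is locally 1-to-1 on $T\setminus\{c_0\}$; (c) all endpoints of $T$ are in $\mathrm{orb}(c_0)$; (d) $c_0$ is periodic; (e) if $x\ne y$ are marked points (branch points or points of $\mathrm{orb}(c_0)$), then $c_0\in f^{\circ n}([x,y])$ for some $n\ge0$. The critical value is $c_1=f(c_0)$. $T\setminus\{c_0\}$ has at most two components; $T_1$ is the one containing $c_1$, $T_0$ the other (possibly empty). The itinerary of $z\in T$ is $\tau(z)=(\tau_i(z))_{i\ge1}$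 with $\tau_i(z)=0,\star,1$ according as $f^{\circ(i-1)}(z)\in T_0$, $=c_0$, $\in T_1$. The kneading sequence of $(T,f)$ is $\tau(c_1)$. If $c_0$ has period $n$, $(T,f)$ has attracting dynamics if each $c_i\in\mathrm{orb}(c_0)$ has a neighborhood $U_i$ with $f^{\circ jn}(x)\to c_i$ as $j\to\infty$ for all $x\in U_i$. $(T,f)$ is minimal if it has attracting dynamics and no two distinct periodic points have the same itinerary. Given a periodic orbit disjoint from $\mathrm{orb}(c_0)$, its points can be labelled uniquely as $z_1,\ldots,z_n$ with $f(z_i)=z_{i+1}$ (indices mod $n$) such that one component of $T\setminus\{z_1\}$ contains $c_1$ and one other component contains $c_0$ and $z_2,\ldots,z_n$; $z_1$ is the characteristic point of this orbit. In addition, $c_1$ is regarded as the characteristic point of the critical orbit. A global arm of $z$ is a component $G$ of $T\setminus\{z\}$; its local arm is the germ of $G$ at $z$, represented by a sufficiently small interval $]z,p[\,\subset G$; it points towards every point of $G$. The image $f^{\circ i}(L)$ of a local arm $L$ of $z$ is the local arm at $f^{\circ i}(z)$ represented by the image of such a small interval. If $z$ has period $n$, the period of $L$ is the smallest $j>0$ with $f^{\circ jn}(L)=L$. For a periodic sequence $\tau=\overline{\tau_1\ldots\tau_n}$ over $\{0,1\}$ of period $n$ and $q\ge1$: $B_q(\tau)=\overline{(\tau_1\ldots\tau_n)^{q-1}\tau_1\ldots\tau_{n-1}\tau_n'}$ with $\tau_n'=1-\tau_n$; and $\mathcal{A}^{-1}_{qn}(\tau)$ is the $\star$-periodic sequence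 of period $qn$ obtained from $\tau$ by replacing, for every $j\in\mathbb{N}$, the $j(qn)$-th entry by $\star$. *)

theory Defs
  imports "HOL-Analysis.Analysis" "HOL-Library.Stream"
begin

definition is_tree :: "'a::metric_space set \<Rightarrow> bool" where
  "is_tree T \<longleftrightarrow> compact T \<and> connected T \<and>
     (\<exists>P. finite P \<and> (\<forall>g\<in>P. arc g) \<and> T = (\<Union>g\<in>P. path_image g)) \<and>
     \<not> (\<exists>g. simple_path g \<and> pathfinish g = pathstart g \<and> path_image g \<subseteq> T)"

definition endpoint :: "'a::metric_space set \<Rightarrow> 'a \<Rightarrow> bool" where
  "endpoint T x \<longleftrightarrow> x \<in> T \<and> card (components (T - {x})) = 1"

(* The complement of a point of a tree has only finitely many components,
   so the convention card A = 0 for infinite A plays no role. *)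
definition branch_point :: "'a::metric_space set \<Rightarrow> 'a \<Rightarrow> bool" where
  "branch_point T x \<longleftrightarrow> x \<in> T \<and> card (components (T - {x})) > 2"

(* [x,y]; library arcs are non-degenerate, so [x,x] = {x} is a separate case. *)
definition closed_arc :: "'a::metric_space set \<Rightarrow> 'a \<Rightarrow> 'a \<Rightarrow> 'a set" where
  "closed_arc T x y =
     (if x = y then {x}
      else (THE A. A \<subseteq> T \<and> (\<exists>g. arc g \<and> pathstart g = x \<and> pathfinish g = y \<and> path_image g = A)))"

definition open_arc :: "'a::metric_space set \<Rightarrow> 'a \<Rightarrow> 'a \<Rightarrow> 'a set" where
  "open_arc T x y = closed_arc T x y - {x, y}"

(* ]x,y] *)
definition left_open_arc :: "'a::metric_space set \<Rightarrow> 'a \<Rightarrow> 'a \<Rightarrow> 'a set" where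
  "left_open_arc T x y = closed_arc T x y - {x}"

definition orb :: "('a \<Rightarrow> 'a) \<Rightarrow> 'a \<Rightarrow> 'a set" where
  "orb f x = range (\<lambda>n. (f ^^ n) x)"

definition periodic_point :: "('a \<Rightarrow> 'a) \<Rightarrow> 'a \<Rightarrow> bool" where
  "periodic_point f x \<longleftrightarrow> (\<exists>n>0. (f ^^ n) x = x)"

definition period :: "('a \<Rightarrow> 'a) \<Rightarrow> 'a \<Rightarrow> nat" where
  "period f x = (LEAST n. n > 0 \<and> (f ^^ n) x = x)"

definition marked_point :: "'a::metric_space set \<Rightarrow> ('a \<Rightarrow> 'a) \<Rightarrow> 'a \<Rightarrow> 'a \<Rightarrow> bool" where
  "marked_point T f c0 x \<longleftrightarrow> branch_point T x \<or> x \<in> orb f c0"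

(* The map is only relevant on T. The critical point is a distinguished point: f may be
   locally injective at c0 (for instance when c0 is an endpoint of T). *)
definition hubbard_tree :: "'a::metric_space set \<Rightarrow> ('a \<Rightarrow> 'a) \<Rightarrow> 'a \<Rightarrow> bool" where
  "hubbard_tree T f c0 \<longleftrightarrow>
     is_tree T \<and> continuous_on T f \<and> f ` T = T \<and> c0 \<in> T \<and>
     (\<forall>y\<in>T. finite {x\<in>T. f x = y} \<and> card {x\<in>T. f x = y} \<le> 2) \<and>
     (\<forall>x\<in>T - {c0}. \<exists>U. openin (top_of_set T) U \<and> x \<in> U \<and> inj_on f U) \<and>
     (\<forall>x. endpoint T x \<longrightarrow> x \<in> orb f c0) \<and>
     periodic_point f c0 \<and>
     (\<forall>x y. marked_point T f c0 x \<and> marked_point T f c0 y \<and> x \<noteq> y \<longrightarrow>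
        (\<exists>n. c0 \<in> (f ^^ n) ` closed_arc T x y))"

datatype symbol = Zero | Star | One

definition T1_part :: "'a::metric_space set \<Rightarrow> ('a \<Rightarrow> 'a) \<Rightarrow> 'a \<Rightarrow> 'a set" where
  "T1_part T f c0 = connected_component_set (T - {c0}) (f c0)"

(* As T - {c0} has at most two components, the symbol is Zero exactly on the component
   not containing f c0, if there is one. *)
definition position :: "'a::metric_space set \<Rightarrow> ('a \<Rightarrow> 'a) \<Rightarrow> 'a \<Rightarrow> 'a \<Rightarrow> symbol" where
  "position T f c0 z = (if z = c0 then Star else if z \<in> T1_part T f c0 then One else Zero)"

(* Streams are indexed from 0: the i-th entry of an itinerary, i \<ge> 1, is at index i - 1. *)
definition itinerary :: "'a::metric_space set \<Rightarrow> ('a \<Rightarrow> 'a) \<Rightarrow> 'a \<Rightarrow> 'a \<Rightarrow> symbol stream" where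
  "itinerary T f c0 z = smap (position T f c0) (siterate f z)"

definition kneading_sequence :: "'a::metric_space set \<Rightarrow> ('a \<Rightarrow> 'a) \<Rightarrow> 'a \<Rightarrow> symbol stream" where
  "kneading_sequence T f c0 = itinerary T f c0 (f c0)"

definition attracting_dynamics :: "'a::metric_space set \<Rightarrow> ('a \<Rightarrow> 'a) \<Rightarrow> 'a \<Rightarrow> bool" where
  "attracting_dynamics T f c0 \<longleftrightarrow>
     (\<forall>c\<in>orb f c0. \<exists>U. openin (top_of_set T) U \<and> c \<in> U \<and>
        (\<forall>x\<in>U. (\<lambda>j. (f ^^ (j * period f c0)) x) \<longlonglongrightarrow> c))"

definition minimal_hubbard_tree :: "'a::metric_space set \<Rightarrow> ('a \<Rightarrow> 'a) \<Rightarrow> 'a \<Rightarrow> bool" where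
  "minimal_hubbard_tree T f c0 \<longleftrightarrow>
     hubbard_tree T f c0 \<and> attracting_dynamics T f c0 \<and>
     (\<forall>x\<in>T. \<forall>y\<in>T. periodic_point f x \<and> periodic_point f y \<and> x \<noteq> y \<longrightarrow>
        itinerary T f c0 x \<noteq> itinerary T f c0 y)"

definition characteristic_point :: "'a::metric_space set \<Rightarrow> ('a \<Rightarrow> 'a) \<Rightarrow> 'a \<Rightarrow> 'a \<Rightarrow> bool" where
  "characteristic_point T f c0 z \<longleftrightarrow>
     z = f c0 \<or>
     (z \<in> T \<and> periodic_point f z \<and> orb f z \<inter> orb f c0 = {} \<and>
      (\<exists>C\<in>components (T - {z}). \<exists>D\<in>components (T - {z}).
         C \<noteq> D \<and> f c0 \<in> C \<and> c0 \<in> D \<and> orb f z - {z} \<subseteq> D))"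

(* The germ at z of the component of T - {z} containing p. Germs of sets at z are encoded
   as filters: "at z within A" and "at z within B" coincide iff A - {z} and B - {z} agree
   near z. *)
definition local_arm :: "'a::metric_space set \<Rightarrow> 'a \<Rightarrow> 'a \<Rightarrow> 'a filter" where
  "local_arm T z p = at z within connected_component_set (T - {z}) p"

(* The pushforward of a germ of sets is represented by the image of a small representative,
   provided the map is injective on a compact set containing z and that representative. *)
lemma filtermap_germ:
  fixes g :: "'a::metric_space \<Rightarrow> 'a"
  assumes "compact K" "continuous_on K g" "inj_on g K" "z \<in> K" "A \<subseteq> K"
  shows "filtermap g (at z within A) = at (g z) within (g ` A)"
proof -
  obtain h where h: "homeomorphism K (g ` K) g h"
    using homeomorphism_compact[OF assms(1,2) refl assms(3)] by blast
  have hc: "continuous_on (g ` K) h" and hg: "\<And>x. x \<in> K \<Longrightarrow> h (g x) = x"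
    using h by (auto simp: homeomorphism_def)
  have "eventually (\<lambda>x. P (g x)) (at z within A) \<longleftrightarrow> eventually P (at (g z) within (g ` A))" for P
  proof
    assume "eventually (\<lambda>x. P (g x)) (at z within A)"
    then obtain d where "d > 0" and d: "\<And>x. x \<in> A \<Longrightarrow> x \<noteq> z \<Longrightarrow> dist x z < d \<Longrightarrow> P (g x)"
      by (auto simp: eventually_at)
    from hc \<open>d > 0\<close> assms(4) obtain e where "e > 0"
      and e: "\<And>y. y \<in> g ` K \<Longrightarrow> dist y (g z) < e \<Longrightarrow> dist (h y) (h (g z)) < d"
      unfolding continuous_on_iff by blast
    have "P y" if "y \<in> g ` A" "y \<noteq> g z" "dist y (g z) < e" for y
    proof -
      from that(1) obtain x where x: "x \<in> A" "y = g x" by blast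
      have "dist x z < d" using e[of y] that x assms(4,5) hg by (auto simp: subset_iff)
      then show ?thesis using d[of x] x that(2) by auto
    qed
    then show "eventually P (at (g z) within (g ` A))"
      using \<open>e > 0\<close> by (auto simp: eventually_at)
  next
    assume "eventually P (at (g z) within (g ` A))"
    then obtain d where "d > 0"
      and d: "\<And>y. y \<in> g ` A \<Longrightarrow> y \<noteq> g z \<Longrightarrow> dist y (g z) < d \<Longrightarrow> P y"
      by (auto simp: eventually_at)
    from assms(2,4) \<open>d > 0\<close> obtain e where "e > 0"
      and e: "\<And>x. x \<in> K \<Longrightarrow> dist x z < e \<Longrightarrow> dist (g x) (g z) < d"
      unfolding continuous_on_iff by blast
    have "P (g x)" if "x \<in> A" "x \<noteq> z" "dist x z < e" for x
    proof (rule d)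
      show "g x \<noteq> g z" using that assms(3,4,5) by (auto dest: inj_onD)
      show "dist (g x) (g z) < d" using e[of x] that assms(5) by blast
    qed (use that in auto)
    then show "eventually (\<lambda>x. P (g x)) (at z within A)"
      using \<open>e > 0\<close> by (auto simp: eventually_at)
  qed
  then show ?thesis by (simp add: filter_eq_iff eventually_filtermap)
qed

(* L is a local arm at z. *)
definition local_arm_period :: "('a \<Rightarrow> 'a) \<Rightarrow> 'a \<Rightarrow> 'a filter \<Rightarrow> nat" where
  "local_arm_period f z L =
     (LEAST j. j > 0 \<and> filtermap (f ^^ (j * period f z)) L = L)"

definition seq_period :: "'b stream \<Rightarrow> nat" where
  "seq_period s = (LEAST n. n > 0 \<and> sdrop n s = s)"

fun flip :: "symbol \<Rightarrow> symbol" where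
  "flip Zero = One"
| "flip One = Zero"
| "flip Star = Star"

definition B_seq :: "nat \<Rightarrow> symbol stream \<Rightarrow> symbol stream" where
  "B_seq q s = (let w = stake (seq_period s) s in
     cycle (concat (replicate (q - 1) w) @ butlast w @ [flip (last w)]))"

(* Entries are counted from 1 here. *)
definition A_inv :: "nat \<Rightarrow> symbol stream \<Rightarrow> symbol stream" where
  "A_inv m s = smap2 (\<lambda>i a. if m dvd i then Star else a) (fromN 1) s"

end

theory Submission
  imports Defs
begin

text \<open>Put \<open>m = Qn\<close> and \<open>g = f\<^sup>m\<close>, so that \<open>g\<close> fixes \<open>z\<close> and its arm \<open>L\<close> towards \<open>c\<^sub>1\<close>, and no
  earlier return to \<open>z\<close> preserves \<open>L\<close>. As \<open>f\<close> is injective on arcs without \<open>c\<^sub>0\<close> in their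
  interior, follow an arc that leaves \<open>z\<close> along \<open>L\<close> until it first contains a precritical point \<open>x\<close>,
  \<open>f\<^sup>i x = c\<^sub>0\<close> with \<open>i < m\<close>. If \<open>i < m - 1\<close>, then \<open>f\<^bsup>i+1\<^esup>\<close> maps \<open>[z, x]\<close> onto an arc ending in
  \<open>c\<^sub>1\<close> that runs through \<open>z\<close>, and \<open>g\<close> sends the preimage of \<open>z\<close> to the orbit of \<open>z\<close>, on the wrong
  side of \<open>z\<close>. Hence \<open>i = m - 1\<close> and \<open>g\<close> maps \<open>[z, x]\<close> homeomorphically onto \<open>[z, c\<^sub>1]\<close>.

  Such an \<open>x\<close> exists on \<open>[z, c\<^sub>1]\<close>: otherwise the point \<open>b\<close> at which \<open>g c\<^sub>1\<close> branches off \<open>[z, c\<^sub>1]\<close> either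
  bounds an arc \<open>[z, b]\<close> that never meets \<open>c\<^sub>0\<close>, against minimality, or its iterates under \<open>g\<close> are
  infinitely many points of the finite forward invariant set of medians of the orbits of \<open>z\<close> and \<open>c\<^sub>0\<close>.
  If \<open>x = c\<^sub>1\<close>, then \<open>c\<^sub>1\<close> is the closest characteristic point. If not, \<open>g\<close> folds at \<open>x\<close>, and the same
  alternative yields a fixed point of \<open>g\<close> in \<open>]x, c\<^sub>1[\<close> whose itinerary differs from that of \<open>z\<close> exactly at
  the multiples of \<open>m\<close>.\<close>

section \<open>Arcs and betweenness in trees\<close>

definition arc_between :: "'a::metric_space set \<Rightarrow> 'a \<Rightarrow> 'a \<Rightarrow> bool" where
  "arc_between A x y \<longleftrightarrow> (\<exists>g. arc g \<and> pathstart g = x \<and> pathfinish g = y \<and> path_image g = A)"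

lemma arc_betweenE:
  assumes "arc_between A x y"
  obtains g where "continuous_on {0..1} g" "inj_on g {0..1}" "g 0 = x" "g 1 = y" "A = g ` {0..1::real}"
  using assms unfolding arc_between_def arc_def path_def pathstart_def pathfinish_def path_image_def
  by blast

lemma arc_betweenI:
  assumes "continuous_on {0..1} g" "inj_on g {0..1}" "g 0 = x" "g 1 = y" "A = g ` {0..1::real}"
  shows "arc_between A x y"
  using assms unfolding arc_between_def arc_def path_def pathstart_def pathfinish_def path_image_def
  by blast

lemma arc_between_subinterval:
  fixes g :: "real \<Rightarrow> 'a::metric_space"
  assumes "continuous_on {0..1} g" "inj_on g {0..1}" "0 \<le> s" "s < t" "t \<le> 1"
  shows "arc_between (g ` {s..t}) (g s) (g t)"
proof (rule arc_betweenI)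
  let ?h = "\<lambda>u. (t - s) * u + s"
  have img: "?h ` {0..1} = {s..t}"
    using assms image_affinity_atLeastAtMost[of "t - s" s 0 1] by (auto split: if_splits)
  moreover have "{s..t} \<subseteq> {0..1}" using assms by auto
  ultimately show "continuous_on {0..1} (g \<circ> ?h)" "inj_on (g \<circ> ?h) {0..1}"
    using assms(4) by (intro continuous_on_compose comp_inj_on continuous_on_subset[OF assms(1)]
        inj_on_subset[OF assms(2)] continuous_intros; simp add: inj_on_def)+
  show "g ` {s..t} = (g \<circ> ?h) ` {0..1}" using img unfolding image_comp[symmetric] by simp
qed (auto simp: algebra_simps)

lemma arc_between_sym: "arc_between A x y \<Longrightarrow> arc_between A y x"
  unfolding arc_between_def by (metis arc_reversepath path_image_reversepath pathfinish_reversepath pathstart_reversepath)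

lemma arc_between_facts:
  assumes "arc_between A x y"
  shows "x \<in> A" "y \<in> A" "x \<noteq> y" "compact A" "connected A"
  using assms unfolding arc_between_def
  by (auto simp: compact_arc_image connected_arc_image arc_distinct_ends)
     (metis arc_distinct_ends)

lemma arc_between_join:
  assumes "arc_between A x y" "arc_between B y w" "A \<inter> B \<subseteq> {y}"
  shows "arc_between (A \<union> B) x w"
proof -
  obtain g h where "arc g" "pathstart g = x" "pathfinish g = y" "path_image g = A"
    "arc h" "pathstart h = y" "pathfinish h = w" "path_image h = B"
    using assms unfolding arc_between_def by auto
  then show ?thesis unfolding arc_between_def using assms
    by (intro exI[of _ "g +++ h"]) (auto intro!: arc_join simp: path_image_join)
qed

lemma arc_between_loop:
  assumes "arc_between A x y" "arc_between B y x" "A \<inter> B \<subseteq> {x, y}"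
  shows "\<exists>g. simple_path g \<and> pathfinish g = pathstart g \<and> path_image g = A \<union> B"
proof -
  obtain g h where "arc g" "pathstart g = x" "pathfinish g = y" "path_image g = A"
    "arc h" "pathstart h = y" "pathfinish h = x" "path_image h = B"
    using assms unfolding arc_between_def by auto
  then show ?thesis using assms
    by (intro exI[of _ "g +++ h"]) (auto intro!: simple_path_join_loop simp: path_image_join)
qed

lemma arc_between_split:
  assumes "arc_between A x y" "u \<in> A" "u \<noteq> x" "u \<noteq> y"
  obtains A1 A2 where "arc_between A1 x u" "arc_between A2 u y" "A = A1 \<union> A2" "A1 \<inter> A2 = {u}"
proof -
  obtain g where g: "continuous_on {0..1} g" "inj_on g {0..1}" "g 0 = x" "g 1 = y" "A = g ` {0..1::real}"
    using arc_betweenE[OF assms(1)] .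
  then obtain t where t: "u = g t" "t \<in> {0..1}" using assms by auto
  then have t': "0 < t" "t < 1" using assms g by (auto simp: less_eq_real_def)
  show ?thesis
  proof (rule that)
    show "arc_between (g ` {0..t}) x u" "arc_between (g ` {t..1}) u y"
      using arc_between_subinterval[OF g(1,2), of 0 t] arc_between_subinterval[OF g(1,2), of t 1] t t' g
      by auto
    have "{0..1} = {0..t} \<union> {t..1}" using t' by auto
    then show "A = g ` {0..t} \<union> g ` {t..1}" using g by auto
    have "g ` {0..t} \<inter> g ` {t..1} = g ` ({0..t} \<inter> {t..1})"
      using t' by (intro inj_on_image_Int[symmetric, OF g(2)]) auto
    also have "{0..t} \<inter> {t..1} = {t}" using t' by auto
    finally show "g ` {0..t} \<inter> g ` {t..1} = {u}" using t by auto
  qed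
qed

lemma arc_between_points:
  assumes "arc_between A x y" "u \<in> A" "v \<in> A" "u \<noteq> v"
  obtains E where "E \<subseteq> A" "arc_between E u v"
proof -
  obtain g where g: "continuous_on {0..1} g" "inj_on g {0..1}" "g 0 = x" "g 1 = y" "A = g ` {0..1::real}"
    using arc_betweenE[OF assms(1)] .
  then obtain s t where st: "u = g s" "s \<in> {0..1}" "v = g t" "t \<in> {0..1}" using assms by auto
  then consider "s < t" | "t < s" using assms by force
  then show ?thesis
  proof cases
    case 1
    then show ?thesis using arc_between_subinterval[OF g(1,2), of s t] st g
      by (intro that[of "g ` {s..t}"]) auto
  next
    case 2
    then show ?thesis using arc_between_subinterval[OF g(1,2), of t s] st g
      by (intro that[of "g ` {t..s}"]) (auto intro: arc_between_sym)
  qed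
qed

lemma arc_between_first_hit:
  assumes "arc_between A x y" "closed K" "K \<inter> A \<noteq> {}" "x \<notin> K"
  obtains u A' where "u \<in> K" "A' \<subseteq> A" "arc_between A' x u" "A' \<inter> K = {u}"
proof -
  obtain g where g: "continuous_on {0..1} g" "inj_on g {0..1}" "g 0 = x" "g 1 = y" "A = g ` {0..1::real}"
    using arc_betweenE[OF assms(1)] .
  let ?S = "{0..1} \<inter> g -` K"
  have "closed ?S" by (intro continuous_closed_preimage g assms) auto
  then have "compact ?S" by (simp add: compact_eq_bounded_closed bounded_Int)
  moreover have "?S \<noteq> {}" using assms g by auto
  ultimately obtain t where t: "t \<in> ?S" "\<And>s. s \<in> ?S \<Longrightarrow> t \<le> s"
    using compact_attains_inf[of ?S] by blast
  have "t \<noteq> 0" using t g assms by auto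
  then have t0: "0 < t" "t \<le> 1" using t by auto
  show ?thesis
  proof (rule that[of "g t" "g ` {0..t}"])
    show "arc_between (g ` {0..t}) x (g t)"
      using arc_between_subinterval[OF g(1,2), of 0 t] t0 g by auto
    have "s = t" if "s \<in> {0..t}" "g s \<in> K" for s
      using t(2)[of s] that t0 by auto
    then show "g ` {0..t} \<inter> K = {g t}" using t t0 by (auto intro!: arg_cong[of _ _ g])
  qed (use t t0 g in auto)
qed

lemma arc_between_merge:
  assumes A: "arc_between A x y" and B: "arc_between B y w" and "x \<noteq> w"
  obtains C where "C \<subseteq> A \<union> B" "arc_between C x w"
proof (cases "x \<in> B")
  case True
  then obtain E where "E \<subseteq> B" "arc_between E x w"
    using arc_between_points[OF B, of x w] arc_between_facts[OF B] assms by blast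
  then show ?thesis using that by blast
next
  case False
  obtain u A' where u: "u \<in> B" "A' \<subseteq> A" "arc_between A' x u" "A' \<inter> B = {u}"
    using arc_between_first_hit[OF A, of B] False arc_between_facts[OF A] arc_between_facts[OF B]
    by (metis compact_imp_closed disjoint_iff)
  show ?thesis
  proof (cases "u = w")
    case True then show ?thesis using u that by blast
  next
    case False
    then obtain E where "E \<subseteq> B" "arc_between E u w"
      using arc_between_points[OF B, of u w] u(1) arc_between_facts[OF B] by blast
    then show ?thesis using arc_between_join[OF u(3), of E w] u(2,4) that[of "A' \<union> E"] by blast
  qed
qed

text \<open>From a point \<open>u\<close> of \<open>A\<close> off \<open>B\<close>, both directions
  along \<open>A\<close> lead back to \<open>B\<close>. The piece of \<open>A\<close> between the
  two first returns and the piece of \<open>B\<close> joining them would form a simple closed curve.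
  One inclusion is enough, as \<open>A\<close> and \<open>B\<close> can be exchanged.\<close>

lemma arc_between_unique:
  assumes noloop: "\<not> (\<exists>g. simple_path g \<and> pathfinish g = pathstart g \<and> path_image g \<subseteq> T)"
    and A: "arc_between A x y" "A \<subseteq> T" and B: "arc_between B x y" "B \<subseteq> T"
  shows "A \<subseteq> B"
proof (rule subsetI, rule ccontr)
  fix u assume u: "u \<in> A" "u \<notin> B"
  have cB: "closed B" using arc_between_facts[OF B(1)] compact_imp_closed by blast
  obtain A1 A2 where sp: "arc_between A1 x u" "arc_between A2 u y" "A = A1 \<union> A2" "A1 \<inter> A2 = {u}"
    using arc_between_split[OF A(1) u(1)] u(2) arc_between_facts[OF B(1)] by metis
  obtain v1 D1 where 1: "v1 \<in> B" "D1 \<subseteq> A1" "arc_between D1 u v1" "D1 \<inter> B = {v1}"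
    using arc_between_first_hit[OF arc_between_sym[OF sp(1)] cB] u
      arc_between_facts[OF sp(1)] arc_between_facts[OF B(1)]
    by (metis disjoint_iff)
  obtain v2 D2 where 2: "v2 \<in> B" "D2 \<subseteq> A2" "arc_between D2 u v2" "D2 \<inter> B = {v2}"
    using arc_between_first_hit[OF sp(2) cB] u
      arc_between_facts[OF sp(2)] arc_between_facts[OF B(1)]
    by (metis disjoint_iff)
  have "v1 \<in> A1" "v2 \<in> A2" using 1(2,4) 2(2,4) by auto
  then have "v1 \<noteq> v2" using 1(1) sp(4) u(2) by auto
  have D: "arc_between (D1 \<union> D2) v1 v2"
    by (rule arc_between_join[OF arc_between_sym[OF 1(3)] 2(3)]) (use 1(2) 2(2) sp(4) in auto)
  obtain E where E: "E \<subseteq> B" "arc_between E v2 v1"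
    using arc_between_points[OF B(1) 2(1) 1(1)] \<open>v1 \<noteq> v2\<close> by metis
  have "(D1 \<union> D2) \<inter> E \<subseteq> {v1, v2}" using 1(4) 2(4) E(1) by auto
  from arc_between_loop[OF D E(2) this] obtain g where
    "simple_path g" "pathfinish g = pathstart g" "path_image g = D1 \<union> D2 \<union> E" by blast
  moreover have "D1 \<union> D2 \<union> E \<subseteq> T" using 1(2) 2(2) E(1) sp(3) A(2) B(2) by auto
  ultimately show False using noloop by (metis le_sup_iff)
qed

lemma arc_between_image:
  assumes "arc_between A x y" "continuous_on A f" "inj_on f A"
  shows "arc_between (f ` A) (f x) (f y)"
proof -
  obtain g where g: "continuous_on {0..1} g" "inj_on g {0..1}" "g 0 = x" "g 1 = y" "A = g ` {0..1::real}"
    using arc_betweenE[OF assms(1)] .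
  show ?thesis
  proof (rule arc_betweenI[of "f \<circ> g"])
    show "continuous_on {0..1} (f \<circ> g)" "inj_on (f \<circ> g) {0..1}"
      using g assms by (auto intro!: continuous_on_compose comp_inj_on simp del: o_apply)
    show "f ` A = (f \<circ> g) ` {0..1}" using g by (simp add: image_comp)
  qed (use g in auto)
qed

section \<open>Unique arcs in a tree and the order along them\<close>

locale tree =
  fixes T :: "'a::metric_space set"
  assumes is_tree: "is_tree T"
begin

abbreviation seg :: "'a \<Rightarrow> 'a \<Rightarrow> 'a set" where "seg \<equiv> closed_arc T"

lemma connected_T: "connected T"
  and no_loop: "\<not> (\<exists>g. simple_path g \<and> pathfinish g = pathstart g \<and> path_image g \<subseteq> T)"
  using is_tree unfolding is_tree_def by auto

lemma finite_arcs:
  obtains P where "finite P" "\<And>A. A \<in> P \<Longrightarrow> \<exists>x y. arc_between A x y" "T = \<Union>P"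
proof -
  obtain P where "finite P" "\<forall>g\<in>P. arc g" "T = (\<Union>g\<in>P. path_image g)"
    using is_tree unfolding is_tree_def by auto
  then show ?thesis
    by (intro that[of "path_image ` P"]) (auto simp: arc_between_def)
qed

text \<open>Reachability from \<open>x\<close> by an arc spreads along each of the finitely many
  pieces of \<open>T\<close>. The reachable pieces and the others thus have disjoint closed unions
  covering \<open>T\<close>, and connectedness leaves the second one empty.\<close>

lemma arc_exists:
  assumes "x \<in> T" "y \<in> T" "x \<noteq> y"
  shows "\<exists>A\<subseteq>T. arc_between A x y"
proof -
  obtain P where P: "finite P" "\<And>A. A \<in> P \<Longrightarrow> \<exists>x y. arc_between A x y" "T = \<Union>P"
    using finite_arcs by blast
  define R where "R u \<longleftrightarrow> x = u \<or> (\<exists>A\<subseteq>T. arc_between A x u)" for u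
  have step: "R v" if "A \<in> P" "u \<in> A" "v \<in> A" "R u" for A u v
  proof (cases "u = v \<or> x = v")
    case False
    then obtain E where E: "E \<subseteq> A" "arc_between E u v" 
      using P(2)[OF \<open>A \<in> P\<close>] arc_between_points[OF _ \<open>u \<in> A\<close> \<open>v \<in> A\<close>] by metis
    have "E \<subseteq> T" using E P that by auto
    show ?thesis
    proof (cases "x = u")
      case True then show ?thesis using E \<open>E \<subseteq> T\<close> R_def by auto
    next
      case F: False
      then obtain B where B: "B \<subseteq> T" "arc_between B x u" using \<open>R u\<close> R_def by auto
      obtain C where "C \<subseteq> B \<union> E" "arc_between C x v"
        using arc_between_merge[OF B(2) E(2)] False by metis
      then show ?thesis using B \<open>E \<subseteq> T\<close> R_def by blast
    qed
  qed (use that R_def in auto)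
  let ?U = "\<Union>{A\<in>P. \<exists>u\<in>A. R u}" and ?V = "\<Union>{A\<in>P. \<not> (\<exists>u\<in>A. R u)}"
  have cl: "closed A" if "A \<in> P" for A using P(2)[OF that] arc_between_facts compact_imp_closed by metis
  have "closed ?U" "closed ?V" by (rule closed_Union; use P cl in auto)+
  moreover have "?U \<union> ?V = T" using P(3) by blast
  moreover have "?U \<inter> ?V = {}" using step by blast
  moreover have "x \<in> ?U" using assms P R_def by auto
  ultimately have "?V = {}"
    using connected_closedD[OF connected_T, of ?U ?V] assms(1) P(3) by blast
  then have "y \<in> ?U" using \<open>?U \<union> ?V = T\<close> assms by auto
  then have "R y" using step by blast
  then show ?thesis using assms R_def by auto
qed

lemma seg_arc:
  assumes "x \<in> T" "y \<in> T" "x \<noteq> y"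
  shows "arc_between (seg x y) x y" "seg x y \<subseteq> T"
proof -
  obtain A where A: "A \<subseteq> T" "arc_between A x y" using arc_exists[OF assms] by auto
  have "(THE A. A \<subseteq> T \<and> arc_between A x y) = A"
    by (rule the_equality) (use A arc_between_unique[OF no_loop] in blast)+
  then have "seg x y = A" using assms by (simp add: closed_arc_def arc_between_def)
  then show "arc_between (seg x y) x y" "seg x y \<subseteq> T" using A by auto
qed

lemma seg_eqI:
  assumes "arc_between A x y" "A \<subseteq> T"
  shows "seg x y = A"
proof -
  have "x \<in> T" "y \<in> T" "x \<noteq> y" using assms arc_between_facts[OF assms(1)] by auto
  from seg_arc[OF this] show ?thesis using assms arc_between_unique[OF no_loop] by blast
qed

lemma seg_refl [simp]: "seg x x = {x}"
  by (simp add: closed_arc_def)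

lemma seg_sym: assumes "x \<in> T" "y \<in> T" shows "seg x y = seg y x"
  using assms seg_arc[of x y] by (cases "x = y") (auto intro!: seg_eqI[symmetric] arc_between_sym)

lemma seg_subset: assumes "x \<in> T" "y \<in> T" shows "seg x y \<subseteq> T"
  using assms seg_arc(2)[of x y] by (cases "x = y") auto

lemma seg_in_T: "\<lbrakk>u \<in> seg x y; x \<in> T; y \<in> T\<rbrakk> \<Longrightarrow> u \<in> T"
  using seg_subset by blast

lemma seg_ends: assumes "x \<in> T" "y \<in> T" shows "x \<in> seg x y" "y \<in> seg x y"
  using assms arc_between_facts[OF seg_arc(1)] by (cases "x = y"; auto)+

lemma seg_compact: assumes "x \<in> T" "y \<in> T" shows "compact (seg x y)"
  using assms arc_between_facts[OF seg_arc(1)] by (cases "x = y"; auto)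

lemma seg_connected: assumes "x \<in> T" "y \<in> T" shows "connected (seg x y)"
  using assms arc_between_facts[OF seg_arc(1)] by (cases "x = y"; auto)

lemma seg_split:
  assumes "x \<in> T" "y \<in> T" "u \<in> seg x y"
  shows "seg x u \<union> seg u y = seg x y" "seg x u \<inter> seg u y = {u}"
proof -
  have "seg x u \<union> seg u y = seg x y \<and> seg x u \<inter> seg u y = {u}"
  proof (cases "u = x \<or> u = y")
    case True then show ?thesis using assms seg_ends by auto
  next
    case False
    then have "x \<noteq> y" using assms by auto
    note s = seg_arc[OF assms(1,2) this]
    obtain A1 A2 where sp: "arc_between A1 x u" "arc_between A2 u y" "seg x y = A1 \<union> A2" "A1 \<inter> A2 = {u}"
      using arc_between_split[OF s(1) assms(3)] False by metis
    have "seg x u = A1" "seg u y = A2" by (rule seg_eqI; use sp s in auto)+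
    then show ?thesis using sp by auto
  qed
  then show "seg x u \<union> seg u y = seg x y" "seg x u \<inter> seg u y = {u}" by auto
qed

lemma seg_join:
  assumes "x \<in> T" "y \<in> T" "u \<in> T" "seg x u \<inter> seg u y \<subseteq> {u}"
  shows "u \<in> seg x y"
proof (cases "u = x \<or> u = y")
  case True then show ?thesis using assms seg_ends by auto
next
  case False
  then have "arc_between (seg x u \<union> seg u y) x y"
    using assms by (intro arc_between_join[of _ x u] seg_arc) auto
  then have "seg x y = seg x u \<union> seg u y" using seg_subset assms by (intro seg_eqI) auto
  then show ?thesis using seg_ends assms by auto
qed

lemma seg_triangle:
  assumes "x \<in> T" "y \<in> T" "w \<in> T"
  shows "seg x y \<subseteq> seg x w \<union> seg w y"
proof (cases "x = y \<or> x = w \<or> w = y")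
  case True then show ?thesis using assms seg_ends by auto
next
  case False
  then obtain C where "C \<subseteq> seg x w \<union> seg w y" "arc_between C x y"
    using arc_between_merge[OF seg_arc(1)[of x w] seg_arc(1)[of w y]] assms by metis
  moreover then have "seg x y = C" using seg_subset assms by (intro seg_eqI) blast+
  ultimately show ?thesis by simp
qed

text \<open>On the way from \<open>w\<close> to \<open>x\<close>, the first point on
  \<open>seg x y\<close> serves: the way so far meets \<open>seg x y\<close> only there, so it
  prolongs either half of \<open>seg x y\<close> to an arc ending at \<open>w\<close>.\<close>

lemma median_exists:
  assumes "x \<in> T" "y \<in> T" "w \<in> T"
  shows "\<exists>b. b \<in> seg x y \<and> b \<in> seg y w \<and> b \<in> seg x w"
proof (cases "w \<in> seg x y")
  case True then show ?thesis using assms seg_ends by auto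
next
  case False
  then have "w \<noteq> x" using assms seg_ends by auto
  obtain u A' where u: "u \<in> seg x y" "A' \<subseteq> seg w x" "arc_between A' w u" "A' \<inter> seg x y = {u}"
    using arc_between_first_hit[OF seg_arc(1)[OF assms(3,1) \<open>w \<noteq> x\<close>], of "seg x y"]
      False seg_ends[OF assms(1,2)] seg_ends[OF assms(3,1)] compact_imp_closed[OF seg_compact[OF assms(1,2)]]
    by blast
  have uT: "u \<in> T" using u seg_subset assms by blast
  have "seg w u = A'" using u seg_subset assms by (intro seg_eqI) blast+
  then have i: "seg w u \<inter> seg x y = {u}" "seg u w \<inter> seg x y = {u}" using u seg_sym uT assms by auto
  have "seg x u \<union> seg u y = seg x y" using seg_split u assms by auto
  then have "u \<in> seg x w" "u \<in> seg y w"
    using seg_join[OF assms(1,3) uT] seg_join[OF assms(2,3) uT] i seg_sym uT assms by auto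
  then show ?thesis using u by auto
qed

lemma seg_mono: assumes "x \<in> T" "y \<in> T" "u \<in> seg x y" shows "seg x u \<subseteq> seg x y" "seg u y \<subseteq> seg x y"
  using seg_split[OF assms] by auto

lemma seg_between:
  assumes "x \<in> T" "y \<in> T" "u \<in> seg x y" "v \<in> seg x u"
  shows "u \<in> seg v y"
proof -
  have T: "u \<in> T" "v \<in> T" using seg_subset assms by blast+
  have "seg v u \<subseteq> seg x u" using seg_mono assms T by blast
  then show ?thesis using seg_split[OF assms(1-3)] by (intro seg_join) (use assms T in auto)
qed

text \<open>With \<open>x\<close> as root, \<open>u \<in> seg x v\<close> is an order on the tree in
  which the points below a given one form a chain. This lemma and the next two supply linearity,
  antisymmetry and transitivity.\<close>

lemma seg_linear:
  assumes "x \<in> T" "y \<in> T" "u \<in> seg x y" "v \<in> seg x y"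
  shows "v \<in> seg x u \<or> u \<in> seg x v"
proof -
  have T: "u \<in> T" "v \<in> T" using seg_subset assms by blast+
  have "v \<in> seg x u \<or> v \<in> seg u y" using seg_split[OF assms(1-3)] assms(4) by auto
  moreover have "u \<in> seg x v" if "v \<in> seg u y"
    using seg_between[of y x u v] that assms T by (metis seg_sym)
  ultimately show ?thesis by auto
qed

lemma seg_antisym:
  assumes "x \<in> T" "u \<in> T" "v \<in> T" "u \<in> seg x v" "v \<in> seg x u"
  shows "u = v"
  using seg_split(2)[OF assms(1,2,5)] assms seg_ends by blast

lemma seg_trans:
  assumes "x \<in> T" "w \<in> T" "u \<in> seg x v" "v \<in> seg x w"
  shows "u \<in> seg x w"
  using seg_mono assms by blast

end

section \<open>Local structure of trees\<close>

lemma closed_avoid: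
  assumes "closed K" "p \<notin> K"
  obtains e where "e > 0" "\<And>q. dist q p < e \<Longrightarrow> q \<notin> K"
  using assms unfolding closed_def open_dist by blast

context tree begin

text \<open>Close to \<open>z\<close> only those pieces of \<open>T\<close> that contain
  \<open>z\<close> are visible. Cutting each at \<open>z\<close> leaves two spokes of a star, and
  \<open>S\<close> collects their outer ends.\<close>

lemma near_star:
  assumes "z \<in> T"
  obtains S e where "finite S" "S \<subseteq> T" "e > 0"
    "\<And>u. u \<in> T \<Longrightarrow> dist u z < e \<Longrightarrow> \<exists>a\<in>S. u \<in> seg z a"
proof -
  obtain P where P: "finite P" "\<And>A. A \<in> P \<Longrightarrow> \<exists>x y. arc_between A x y" "T = \<Union>P"
    using finite_arcs by blast
  then obtain l r where lr: "\<And>A. A \<in> P \<Longrightarrow> arc_between A (l A) (r A)" by metis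
  let ?K = "\<Union>{A\<in>P. z \<notin> A}"
  have "closed ?K"
    by (rule closed_Union) (use P lr in \<open>auto intro: compact_imp_closed arc_between_facts(4)\<close>)
  moreover have "z \<notin> ?K" by auto
  ultimately obtain e where e: "e > 0" "\<And>q. dist q z < e \<Longrightarrow> q \<notin> ?K"
    using closed_avoid by blast
  show ?thesis
  proof (rule that[of "l ` P \<union> r ` P" e])
    have "l A \<in> T \<and> r A \<in> T" if "A \<in> P" for A
      using arc_between_facts(1,2)[OF lr[OF that]] that P(3) by blast
    then show "l ` P \<union> r ` P \<subseteq> T" by auto
    fix u assume u: "u \<in> T" "dist u z < e"
    then have "u \<notin> ?K" using e(2) by blast
    then obtain A where A: "A \<in> P" "u \<in> A" "z \<in> A" using u P by auto
    have "A \<subseteq> T" using A P by auto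
    then have s: "seg (l A) (r A) = A" using lr[OF A(1)] seg_eqI by auto
    have lrT: "l A \<in> T" "r A \<in> T" using arc_between_facts[OF lr[OF A(1)]] \<open>A \<subseteq> T\<close> by auto
    then have "u \<in> seg (l A) z \<union> seg z (r A)" using seg_split[of "l A" "r A" z] A s by auto
    then show "\<exists>a\<in>l ` P \<union> r ` P. u \<in> seg z a" using A seg_sym lrT assms by auto
  qed (use P e in auto)
qed

text \<open>A nearby \<open>q\<close> lies on a spoke \<open>seg p a\<close> of the star at
  \<open>p\<close>. If \<open>u\<close> came before \<open>q\<close> on it, \<open>q\<close> would
  lie on the outer part \<open>seg u a\<close>, a compact set missing \<open>p\<close>.\<close>

lemma near_seg_avoid:
  assumes "p \<in> T" "u \<in> T" "u \<noteq> p"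
  obtains e where "e > 0" "\<And>q. q \<in> T \<Longrightarrow> dist q p < e \<Longrightarrow> u \<notin> seg p q"
proof -
  obtain S d where S: "finite S" "S \<subseteq> T" "d > 0"
    "\<And>u. u \<in> T \<Longrightarrow> dist u p < d \<Longrightarrow> \<exists>a\<in>S. u \<in> seg p a"
    using near_star[OF assms(1)] by blast
  let ?K = "\<Union>a\<in>{a\<in>S. u \<in> seg p a}. seg u a"
  have "closed ?K"
    by (rule closed_UN) (use S assms in \<open>auto intro: compact_imp_closed seg_compact\<close>)
  moreover have "p \<notin> ?K"
  proof
    assume "p \<in> ?K"
    then obtain a where a: "a \<in> S" "u \<in> seg p a" "p \<in> seg u a" by auto
    then have "p \<in> seg p u" "p \<in> seg u a" using seg_ends assms by auto
    moreover have "a \<in> T" using a(1) S(2) by blast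
    then have "seg p u \<inter> seg u a = {u}" using seg_split(2)[OF assms(1) _ a(2)] by blast
    ultimately show False using assms(3) by auto
  qed
  ultimately obtain e where e: "e > 0" "\<And>q. dist q p < e \<Longrightarrow> q \<notin> ?K"
    using closed_avoid by blast
  show ?thesis
  proof (rule that[of "min d e"])
    fix q assume q: "q \<in> T" "dist q p < min d e"
    then obtain a where a: "a \<in> S" "q \<in> seg p a" using S by auto
    then have aT: "a \<in> T" using S by auto
    show "u \<notin> seg p q"
    proof
      assume u: "u \<in> seg p q"
      then have "u \<in> seg p a" using a seg_trans assms aT by blast
      moreover have "q \<in> seg u a" using seg_between[OF assms(1) aT a(2) u] .
      ultimately have "q \<in> ?K" using a by auto
      then show False using e(2)[of q] q by auto
    qed
  qed (use S e in auto)
qed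

lemma connected_component_iff:
  assumes "u \<in> T" "x \<in> T" "y \<in> T" "x \<noteq> u" "y \<noteq> u"
  shows "connected_component (T - {u}) x y \<longleftrightarrow> u \<notin> seg x y"
proof
  assume "u \<notin> seg x y"
  then have "connected (seg x y)" "seg x y \<subseteq> T - {u}" "x \<in> seg x y" "y \<in> seg x y"
    using seg_connected[of x y] seg_subset[of x y] seg_ends[of x y] assms by auto
  then show "connected_component (T - {u}) x y" unfolding connected_component_def by blast
next
  assume "connected_component (T - {u}) x y"
  then obtain C where C: "connected C" "C \<subseteq> T - {u}" "x \<in> C" "y \<in> C"
    unfolding connected_component_def by blast
  let ?A = "{q\<in>C. u \<notin> seg x q}" and ?B = "{q\<in>C. u \<in> seg x q}"
  \<comment> \<open>Whether \<open>u\<close> separates a point from \<open>x\<close> is locally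
    constant along \<open>C\<close>, because a small move does not cross \<open>u\<close>; hence it
    is constant on the connected set \<open>C\<close>.\<close>
  have near: "\<exists>e>0. \<forall>q'\<in>C. dist q' q < e \<longrightarrow> (u \<in> seg x q' \<longleftrightarrow> u \<in> seg x q)" if "q \<in> C" for q
  proof -
    have q: "q \<in> T" "u \<noteq> q" using that C by auto
    obtain e where e: "e > 0" "\<And>q'. q' \<in> T \<Longrightarrow> dist q' q < e \<Longrightarrow> u \<notin> seg q q'"
      using near_seg_avoid[OF q(1) assms(1) q(2)] by blast
    have "u \<in> seg x q' \<longleftrightarrow> u \<in> seg x q" if "q' \<in> C" "dist q' q < e" for q'
      using seg_triangle[of x q q'] seg_triangle[of x q' q] e(2)[of q'] that C q assms seg_sym[of q q']
      by (metis DiffE Un_iff subsetD)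
    then show ?thesis using e by blast
  qed
  have "\<exists>e>0. \<forall>q'\<in>C. dist q' q < e \<longrightarrow> q' \<in> ?A" if "q \<in> ?A" for q
    using near[of q] that by auto
  moreover have "\<exists>e>0. \<forall>q'\<in>C. dist q' q < e \<longrightarrow> q' \<in> ?B" if "q \<in> ?B" for q
    using near[of q] that by auto
  ultimately have "openin (top_of_set C) ?A" "openin (top_of_set C) ?B"
    unfolding openin_euclidean_subtopology_iff by simp_all
  moreover have "?A \<union> ?B = C" "?A \<inter> ?B = {}" by auto
  moreover have "x \<in> ?A" using C assms by auto
  ultimately have "?B = {}" using C(1) unfolding connected_openin_eq by blast
  then show "u \<notin> seg x y" using C by auto
qed

text \<open>Near \<open>z\<close>, a spoke that leaves \<open>seg z w\<close> already at
  \<open>z\<close> is outside the component, and one that leaves later agrees with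
  \<open>seg z w\<close> up to the median \<open>b a\<close>. Below the distance \<open>r\<close>
  component and arc therefore coincide.\<close>

lemma local_arm_seg:
  assumes "z \<in> T" "w \<in> T" "w \<noteq> z"
  shows "local_arm T z w = at z within seg z w"
proof -
  let ?C = "connected_component_set (T - {z}) w"
  obtain S d where S: "finite S" "S \<subseteq> T" "d > 0"
    "\<And>u. u \<in> T \<Longrightarrow> dist u z < d \<Longrightarrow> \<exists>a\<in>S. u \<in> seg z a"
    using near_star[OF assms(1)] by blast
  have "\<exists>b. b \<in> seg z a \<and> b \<in> seg a w \<and> b \<in> seg z w" if "a \<in> S" for a
    using median_exists[of z a w] that S assms by auto
  then obtain b where b: "\<And>a. a \<in> S \<Longrightarrow> b a \<in> seg z a \<and> b a \<in> seg a w \<and> b a \<in> seg z w" by metis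
  have "\<exists>e>0. b a \<noteq> z \<longrightarrow> (\<forall>q\<in>T. dist q z < e \<longrightarrow> b a \<notin> seg z q)" if "a \<in> S" for a
  proof (cases "b a = z")
    case False
    have "b a \<in> T" using b[OF that] that S assms seg_in_T by blast
    then obtain e where "e > 0" "\<And>q. q \<in> T \<Longrightarrow> dist q z < e \<Longrightarrow> b a \<notin> seg z q"
      using near_seg_avoid[OF assms(1) _ False] by metis
    then show ?thesis by blast
  qed (auto intro: exI[of _ 1])
  then obtain e where e: "\<And>a. a \<in> S \<Longrightarrow> e a > 0"
    "\<And>a q. a \<in> S \<Longrightarrow> b a \<noteq> z \<Longrightarrow> q \<in> T \<Longrightarrow> dist q z < e a \<Longrightarrow> b a \<notin> seg z q" by metis
  define r where "r = Min (insert d (e ` S))"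
  have r: "r > 0" "r \<le> d" "\<And>a. a \<in> S \<Longrightarrow> r \<le> e a"
    unfolding r_def using S e by auto
  have 1: "u \<in> seg z w" if u: "u \<in> ?C" "dist u z < r" for u
  proof -
    have uC: "connected_component (T - {z}) w u" using u by simp
    then have uT: "u \<in> T" "u \<noteq> z" using connected_component_in by fastforce+
    obtain a where a: "a \<in> S" "u \<in> seg z a" using S(4) uT u r by force
    have aT: "a \<in> T" using a S by auto
    have bT: "b a \<in> T" using b[OF a(1)] aT assms seg_in_T by blast
    have nz: "z \<notin> seg w u" using uC connected_component_iff assms uT by auto
    have "b a \<noteq> z"
    proof
      assume "b a = z"
      then have "z \<in> seg a w" using b a by auto
      then have "z \<in> seg w a" using seg_sym aT assms by auto
      then have "z \<in> seg w u \<or> z \<in> seg u a" using seg_triangle[of w a u] assms aT uT by auto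
      moreover have "z \<notin> seg u a"
        using seg_split(2)[OF assms(1) aT a(2)] seg_ends[of z u] uT assms by auto
      ultimately show False using nz by auto
    qed
    then have "b a \<notin> seg z u" using e(2)[OF a(1)] uT u r(3)[OF a(1)] by auto
    then have "u \<in> seg z (b a)"
      using seg_linear[OF assms(1) aT, of "b a" u] b[OF a(1)] a by auto
    then show ?thesis using seg_trans b[OF a(1)] assms by blast
  qed
  have 2: "u \<in> ?C" if "u \<in> seg z w" "u \<noteq> z" for u
  proof -
    have uT: "u \<in> T" using that seg_in_T assms by blast
    have "z \<notin> seg u w" using seg_split(2)[OF assms(1,2) that(1)] seg_ends[of z u] that uT assms by auto
    then show ?thesis using connected_component_iff[of z w u] seg_sym uT assms that by auto
  qed
  have "at z within ?C = at z within seg z w"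
  proof (rule at_within_nhd)
    show "?C \<inter> ball z r - {z} = seg z w \<inter> ball z r - {z}"
      using 1 2 by (auto simp: dist_commute)
  qed (use r in auto)
  then show ?thesis by (simp add: local_arm_def)
qed

lemma seg_islimpt:
  assumes "z \<in> T" "w \<in> T" "w \<noteq> z"
  shows "z islimpt seg z w"
  by (rule connected_imp_perfect[OF seg_connected])
    (use assms seg_ends[OF assms(1,2)] in auto)

text \<open>Equal germs share a point other than \<open>z\<close>, because \<open>z\<close> is a
  limit point of each arc; such a point connects \<open>p\<close> to \<open>q\<close> without
  passing through \<open>z\<close>.\<close>

lemma local_arm_eq_iff:
  assumes "z \<in> T" "p \<in> T" "q \<in> T" "p \<noteq> z" "q \<noteq> z"
  shows "local_arm T z p = local_arm T z q \<longleftrightarrow> z \<notin> seg p q"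
proof
  assume "z \<notin> seg p q"
  then have "connected_component (T - {z}) p q" using connected_component_iff assms by auto
  then show "local_arm T z p = local_arm T z q"
    unfolding local_arm_def by (metis connected_component_eq mem_Collect_eq)
next
  assume eq: "local_arm T z p = local_arm T z q"
  then have eq': "at z within seg z p = at z within seg z q" using local_arm_seg assms by auto
  have ev: "eventually (\<lambda>u. u \<in> A \<and> u \<noteq> z) (at z within A)" for A
    by (simp add: eventually_at_filter)
  have "eventually (\<lambda>u. u \<in> seg z q \<and> u \<noteq> z) (at z within seg z p)"
    using ev[of "seg z q"] eq' by simp
  with ev[of "seg z p"] have "eventually (\<lambda>u. u \<in> seg z p \<and> u \<noteq> z \<and> u \<in> seg z q) (at z within seg z p)"
    by eventually_elim auto
  moreover have "at z within seg z p \<noteq> bot"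
    using seg_islimpt assms trivial_limit_within by blast
  ultimately obtain u where u: "u \<in> seg z p" "u \<noteq> z" "u \<in> seg z q"
    using eventually_happens' by blast
  have uT: "u \<in> T" using u seg_in_T assms by blast
  have "z \<notin> seg u p" "z \<notin> seg u q"
    using seg_split(2)[OF assms(1) _ u(1)] seg_split(2)[OF assms(1) _ u(3)] seg_ends[of z u] u uT assms by auto
  then show "z \<notin> seg p q" using seg_triangle[of p q u] seg_sym[of p u] uT assms by auto
qed

lemma finite_local_arms:
  assumes "z \<in> T"
  shows "finite (local_arm T z ` (T - {z}))"
proof -
  obtain S d where S: "finite S" "S \<subseteq> T" "d > 0"
    "\<And>u. u \<in> T \<Longrightarrow> dist u z < d \<Longrightarrow> \<exists>a\<in>S. u \<in> seg z a"
    using near_star[OF assms(1)] by blast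
  have "local_arm T z ` (T - {z}) \<subseteq> local_arm T z ` S"
  proof (rule image_subsetI)
    fix p assume "p \<in> T - {z}"
    then have p: "p \<in> T" "p \<noteq> z" by auto
    obtain u where u: "u \<in> seg z p" "u \<noteq> z" "dist u z < d"
      using seg_islimpt[OF assms p] S(3) unfolding islimpt_approachable by blast
    have uT: "u \<in> T" using u seg_in_T assms p by blast
    obtain a where a: "a \<in> S" "u \<in> seg z a" using S(4) uT u by blast
    have aT: "a \<in> T" "a \<noteq> z" using a S u by auto
    have "z \<notin> seg u p" "z \<notin> seg u a"
      using seg_split(2)[OF assms(1) _ u(1)] seg_split(2)[OF assms(1) _ a(2)] seg_ends[of z u] u uT assms p aT by auto
    then have "z \<notin> seg p a" using seg_triangle[of p a u] seg_sym[of p u] uT assms p aT by auto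
    then have "local_arm T z p = local_arm T z a" using local_arm_eq_iff assms p aT by auto
    then show "local_arm T z p \<in> local_arm T z ` S" using a by auto
  qed
  then show ?thesis using S finite_subset by blast
qed

text \<open>Every point lies on the way from \<open>a\<close> to one of the finitely many ends of
  pieces. An end whose arc from \<open>a\<close> is maximal therefore has nothing beyond it.\<close>

lemma endpoint_exists:
  assumes "a \<in> T" "b \<in> T" "a \<noteq> b"
  obtains e where "endpoint T e" "\<And>x y. x \<in> T \<Longrightarrow> y \<in> T \<Longrightarrow> e \<in> seg x y \<Longrightarrow> e = x \<or> e = y"
proof -
  obtain P where P: "finite P" "\<And>A. A \<in> P \<Longrightarrow> \<exists>x y. arc_between A x y" "T = \<Union>P"
    using finite_arcs by blast
  then obtain l r where lr: "\<And>A. A \<in> P \<Longrightarrow> arc_between A (l A) (r A)" by metis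
  let ?E = "l ` P \<union> r ` P"
  have "l A \<in> T \<and> r A \<in> T" if "A \<in> P" for A
    using arc_between_facts(1,2)[OF lr[OF that]] that P(3) by blast
  then have E: "finite ?E" "?E \<subseteq> T" using P(1) by auto
  have cover: "\<exists>e\<in>?E. y \<in> seg a e" if y: "y \<in> T" for y
  proof -
    obtain A where A: "A \<in> P" "y \<in> A" using y P by auto
    have "A \<subseteq> T" using A P by auto
    then have s: "seg (l A) (r A) = A" using lr[OF A(1)] seg_eqI by auto
    have T: "l A \<in> T" "r A \<in> T" using E A by auto
    obtain m where m: "m \<in> seg a (l A)" "m \<in> seg (l A) (r A)" "m \<in> seg a (r A)"
      using median_exists[OF assms(1) T] by blast
    have mT: "m \<in> T" using m seg_in_T assms T by blast
    have "y \<in> seg (l A) m \<union> seg m (r A)" using seg_split[OF T m(2)] A s by auto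
    then have "y \<in> seg a (l A) \<or> y \<in> seg a (r A)"
      using seg_mono[OF assms(1) T(1) m(1)] seg_mono[OF assms(1) T(2) m(3)] seg_sym[OF T(1) mT] by auto
    then show ?thesis using A by auto
  qed
  \<comment> \<open>Starting from an arc through \<open>b\<close> makes the maximal arc
    non-degenerate, so \<open>e\<close> differs from \<open>a\<close>.\<close>
  obtain e1 where e1: "e1 \<in> ?E" "b \<in> seg a e1" using cover[OF assms(2)] by blast
  obtain M where M: "M \<in> seg a ` ?E" "seg a e1 \<subseteq> M" "\<forall>B\<in>seg a ` ?E. M \<subseteq> B \<longrightarrow> M = B"
    using finite_has_maximal2[of "seg a ` ?E" "seg a e1"] E e1 by blast
  then obtain e where e: "e \<in> ?E" "M = seg a e" by auto
  have eT: "e \<in> T" using e E by auto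
  have "e \<noteq> a" using M e e1 assms by auto
  have max: "y = e" if "y \<in> T" "e \<in> seg a y" for y
  proof -
    obtain e' where e': "e' \<in> ?E" "y \<in> seg a e'" using cover[OF \<open>y \<in> T\<close>] by blast
    have e'T: "e' \<in> T" using e' E by auto
    have "seg a e \<subseteq> seg a e'" using seg_mono[OF assms(1) that(1,2)] seg_mono[OF assms(1) e'T e'(2)] by auto
    then have "y \<in> seg a e" using M(3) e e' by auto
    then show ?thesis using seg_antisym[OF assms(1) eT that(1)] that by auto
  qed
  have ext: "e = x \<or> e = y" if "x \<in> T" "y \<in> T" "e \<in> seg x y" for x y
    using max[of x] max[of y] that seg_triangle[of x y a] seg_sym[of x a] assms by blast
  have "connected (T - {e})"
    unfolding connected_iff_connected_component
    using connected_component_iff[OF eT] ext by blast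
  moreover have "T - {e} \<noteq> {}" using \<open>e \<noteq> a\<close> assms by auto
  ultimately have "components (T - {e}) = {T - {e}}" by (simp add: components_eq_sing_iff)
  then have "endpoint T e" using eT by (simp add: endpoint_def)
  then show ?thesis using that ext by blast
qed

section \<open>Medians of three points, first hits, maps on arcs\<close>

definition is_median :: "'a \<Rightarrow> 'a \<Rightarrow> 'a \<Rightarrow> 'a \<Rightarrow> bool" where
  "is_median b x y w \<longleftrightarrow> b \<in> seg x y \<and> b \<in> seg y w \<and> b \<in> seg x w"

text \<open>\<open>b\<close> is where the arcs from \<open>x\<close> to \<open>y\<close> and to
  \<open>w\<close> part: a common point beyond \<open>b\<close> would lie on both halves of
  \<open>seg y w\<close> cut at \<open>b\<close>, hence be \<open>b\<close>.\<close>

lemma is_median_initial: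
  assumes T: "x \<in> T" "y \<in> T" "w \<in> T" and b: "is_median b x y w" and q: "q \<in> seg x y" "q \<in> seg x w"
  shows "q \<in> seg x b"
proof (rule ccontr)
  assume nq: "q \<notin> seg x b"
  have b': "b \<in> seg x y" "b \<in> seg y w" "b \<in> seg x w" using b is_median_def by auto
  have bT: "b \<in> T" "q \<in> T" using b' q seg_in_T T by blast+
  have "b \<in> seg x q" using seg_linear[OF T(1,2) b'(1) q(1)] nq by auto
  then have "q \<in> seg b y" "q \<in> seg b w"
    using seg_between[OF T(1) T(2) q(1)] seg_between[OF T(1) T(3) q(2)] by auto
  then have "q = b" using seg_split(2)[OF T(2,3) b'(2)] seg_sym[OF bT(1) T(2)] by auto
  then show False using nq seg_ends bT T by auto
qed

lemma is_median_unique: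
  assumes T: "x \<in> T" "y \<in> T" "w \<in> T" and b: "is_median b x y w" "is_median b' x y w"
  shows "b = b'"
proof -
  have "b \<in> T" "b' \<in> T" using b T seg_in_T is_median_def by blast+
  then show ?thesis
    using is_median_initial[OF T b(1), of b'] is_median_initial[OF T b(2), of b] b seg_antisym T
    unfolding is_median_def by blast
qed

lemma finite_medians:
  assumes "finite F" "F \<subseteq> T"
  shows "finite {b. \<exists>x\<in>F. \<exists>y\<in>F. \<exists>w\<in>F. is_median b x y w}"
proof -
  have "{b. \<exists>x\<in>F. \<exists>y\<in>F. \<exists>w\<in>F. is_median b x y w} \<subseteq> (\<lambda>(x,y,w). THE b. is_median b x y w) ` (F \<times> F \<times> F)"
  proof clarify
    fix b x y w assume F: "x \<in> F" "y \<in> F" "w \<in> F" and b: "is_median b x y w"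
    have "(THE b. is_median b x y w) = b"
    proof (rule the_equality)
      show "b' = b" if "is_median b' x y w" for b'
        using is_median_unique[OF _ _ _ that b] F assms(2) by blast
    qed (rule b)
    then show "b \<in> (\<lambda>(x,y,w). THE b. is_median b x y w) ` (F \<times> F \<times> F)"
      using F by (intro image_eqI[of _ _ "(x,y,w)"]) auto
  qed
  then show ?thesis using assms finite_subset by blast
qed

lemma first_hit:
  assumes "x \<in> T" "y \<in> T" "finite H" "H \<inter> seg x y \<noteq> {}"
  obtains u where "u \<in> H" "u \<in> seg x y" "\<forall>v\<in>H. v \<in> seg x u \<longrightarrow> v = u"
proof -
  let ?X = "seg x ` (H \<inter> seg x y)"
  obtain M where M: "M \<in> ?X" "\<forall>B\<in>?X. B \<subseteq> M \<longrightarrow> M = B"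
    using finite_has_minimal[of ?X] assms by auto
  then obtain u where u: "u \<in> H" "u \<in> seg x y" "M = seg x u" by auto
  have uT: "u \<in> T" using u seg_in_T assms by blast
  have "v = u" if v: "v \<in> H" "v \<in> seg x u" for v
  proof -
    have "v \<in> seg x y" using v u seg_trans assms by blast
    then have vT: "v \<in> T" using seg_in_T assms by blast
    have "seg x v \<subseteq> seg x u" using seg_mono assms uT v by blast
    then have "seg x u = seg x v" using M(2) u v \<open>v \<in> seg x y\<close> by blast
    then show ?thesis using v seg_ends[of x u] seg_antisym[of x v u] assms uT vT by auto
  qed
  then show ?thesis using that u by blast
qed

text \<open>Two parameters with equal image and least gap bound a loop without further
  self-intersection, but \<open>T\<close> contains no simple closed curve. Local injectivity keeps
  the gap away from 0. It is not assumed at the ends of the arc, so pairs involving an end are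
  treated after the interior ones.\<close>

lemma inj_on_seg:
  fixes f :: "'a \<Rightarrow> 'a"
  assumes cf: "continuous_on T f" and fT: "f ` T \<subseteq> T" and xy: "x \<in> T" "y \<in> T"
    and loc: "\<And>u. u \<in> seg x y \<Longrightarrow> u \<noteq> x \<Longrightarrow> u \<noteq> y \<Longrightarrow> \<exists>U. openin (top_of_set T) U \<and> u \<in> U \<and> inj_on f U"
  shows "inj_on f (seg x y)"
proof (cases "x = y")
  case False
  obtain g where g: "continuous_on {0..1} g" "inj_on g {0..1}" "g 0 = x" "g 1 = y" "seg x y = g ` {0..1::real}"
    using arc_betweenE[OF seg_arc(1)[OF xy False]] .
  have gT: "g t \<in> T" if "t \<in> {0..1}" for t using g(5) that seg_subset[OF xy] by auto
  define \<phi> where "\<phi> t = f (g t)" for t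
  have c\<phi>: "continuous_on {0..1} \<phi>"
    unfolding \<phi>_def by (rule continuous_on_compose2[OF cf g(1)]) (use gT in auto)
  have \<phi>T: "\<phi> t \<in> T" if "t \<in> {0..1}" for t using gT[OF that] fT \<phi>_def by auto
  have no_cycle: False if st: "0 \<le> s" "s < t" "t \<le> 1" "\<phi> s = \<phi> t" "inj_on \<phi> {s..<t}" for s t
  proof -
    let ?h = "\<lambda>u. (t - s) * u + s"
    have h: "?h u \<in> {s..t}" if "u \<in> {0..1}" for u
    proof -
      have "(t - s) * u \<le> t - s" using that st by (intro mult_left_le) auto
      moreover have "0 \<le> (t - s) * u" using that st by auto
      ultimately show ?thesis by simp
    qed
    have h1: "?h u < t" if "u < 1" for u
    proof -
      have "(t - s) * u < (t - s) * 1" using that st by (intro mult_strict_left_mono) auto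
      then show ?thesis by simp
    qed
    have sub: "{s..t} \<subseteq> {0..1}" using st by auto
    have "path (\<phi> \<circ> ?h)" unfolding path_def
      by (intro continuous_on_compose continuous_intros continuous_on_subset[OF c\<phi>])
        (use h sub in blast)
    moreover have "loop_free (\<phi> \<circ> ?h)" unfolding loop_free_def
    proof (intro ballI impI)
      fix u v assume uv: "u \<in> {0..1}" "v \<in> {0..1::real}" "(\<phi> \<circ> ?h) u = (\<phi> \<circ> ?h) v"
      have eq0: "u' = v'" if "u' \<in> {0..<1}" "v' \<in> {0..<1}" "\<phi> (?h u') = \<phi> (?h v')" for u' v'
      proof -
        have "?h u' \<in> {s..<t}" "?h v' \<in> {s..<t}" using h[of u'] h[of v'] h1[of u'] h1[of v'] that by auto
        then have "?h u' = ?h v'" using st(5) that(3) inj_onD by metis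
        then show ?thesis using st by auto
      qed
      have end1: "\<phi> (?h 1) = \<phi> (?h 0)" using st by auto
      consider "u = 1" "v = 1" | "u = 1" "v \<noteq> 1" | "u \<noteq> 1" "v = 1" | "u \<noteq> 1" "v \<noteq> 1" by blast
      then show "u = v \<or> u = 0 \<and> v = 1 \<or> u = 1 \<and> v = 0"
      proof cases
        case 2 then have "v = 0" using eq0[of v 0] uv end1 by auto
        then show ?thesis using 2 by auto
      next
        case 3 then have "u = 0" using eq0[of u 0] uv end1 by auto
        then show ?thesis using 3 by auto
      next
        case 4 then show ?thesis using eq0[of u v] uv by auto
      qed auto
    qed
    moreover have "pathfinish (\<phi> \<circ> ?h) = pathstart (\<phi> \<circ> ?h)"
      using st by (simp add: pathfinish_def pathstart_def)
    moreover have "\<phi> (?h u) \<in> T" if "u \<in> {0..1}" for u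
      using h[OF that] sub by (intro \<phi>T) blast
    then have "path_image (\<phi> \<circ> ?h) \<subseteq> T" unfolding path_image_def by auto
    ultimately show False using no_loop unfolding simple_path_def by blast
  qed
  have inner: False if ab: "0 < a" "a < b" "b < 1" "\<phi> a = \<phi> b" for a b
  proof -
    let ?G = "{B. open B \<and> inj_on \<phi> (B \<inter> {0..1})}"
    have "\<exists>B\<in>?G. r \<in> B" if r: "r \<in> {a..b}" for r
    proof -
      have r01: "r \<in> {0..1}" "r \<noteq> 0" "r \<noteq> 1" using r ab by auto
      have "g r \<noteq> x" using inj_onD[OF g(2), of r 0] g(3) r01 by auto
      moreover have "g r \<noteq> y" using inj_onD[OF g(2), of r 1] g(4) r01 by auto
      moreover have "g r \<in> seg x y" using r01 g(5) by auto
      ultimately obtain U where U: "openin (top_of_set T) U" "g r \<in> U" "inj_on f U" using loc by blast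
      obtain W where W: "open W" "U = T \<inter> W" using U(1) openin_open by blast
      have "openin (top_of_set {0..1}) ({0..1} \<inter> g -` W)"
        using continuous_openin_preimage_gen[OF g(1) W(1)] .
      then obtain N where N: "open N" "{0..1} \<inter> g -` W = {0..1} \<inter> N" using openin_open by blast
      have mem: "g p \<in> U" if "p \<in> N" "p \<in> {0..1}" for p
      proof -
        have "p \<in> {0..1} \<inter> g -` W" using N that by blast
        then show ?thesis using W gT by auto
      qed
      have "inj_on \<phi> (N \<inter> {0..1})"
      proof (rule inj_onI)
        fix p q assume pq: "p \<in> N \<inter> {0..1}" "q \<in> N \<inter> {0..1}" "\<phi> p = \<phi> q"
        have "g p = g q" using inj_onD[OF U(3), of "g p" "g q"] mem pq \<phi>_def by auto
        then show "p = q" using inj_onD[OF g(2), of p q] pq by auto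
      qed
      moreover have "r \<in> N" using N W U r01 by blast
      ultimately show ?thesis using N by auto
    qed
    then have cov: "{a..b} \<subseteq> \<Union>?G" by blast
    have opn: "open B" if "B \<in> ?G" for B using that by simp
    \<comment> \<open>A Lebesgue number for the cover of \<open>{a..b}\<close> by sets on which
      \<phi> is injective.\<close>
    obtain \<epsilon> where \<epsilon>: "\<epsilon> > 0" "\<And>x. x \<in> {a..b} \<Longrightarrow> \<exists>B\<in>?G. ball x \<epsilon> \<subseteq> B"
    proof (rule Heine_Borel_lemma[OF compact_Icc cov opn])
      fix \<epsilon> :: real
      assume "0 < \<epsilon>" and "\<And>x. x \<in> {a..b} \<Longrightarrow> \<exists>B\<in>?G. ball x \<epsilon> \<subseteq> B"
      then show thesis by (rule that)
    qed
    have near: "s = t" if "s \<in> {a..b}" "t \<in> {a..b}" "\<phi> s = \<phi> t" "dist s t < \<epsilon>" for s t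
    proof -
      obtain B where B: "inj_on \<phi> (B \<inter> {0..1})" "ball s \<epsilon> \<subseteq> B" using \<epsilon>(2)[OF \<open>s \<in> {a..b}\<close>] by auto
      have "s \<in> B \<inter> {0..1}" "t \<in> B \<inter> {0..1}" using B(2) that ab \<epsilon>(1) by auto
      then show ?thesis using B(1) that(3) inj_onD by metis
    qed
    let ?X = "{a..b} \<times> {a..b}"
    \<comment> \<open>By \<open>near\<close>, distinct parameters with equal image are at least
      \<epsilon> apart. Demanding this gap loses none of them and makes the set of pairs compact, so
      that a pair of least gap exists.\<close>
    let ?D = "(?X \<inter> (\<lambda>p. dist (\<phi> (fst p)) (\<phi> (snd p))) -` {0}) \<inter> {p. fst p + \<epsilon> \<le> snd p}"
    have cX: "continuous_on ?X (\<lambda>p. dist (\<phi> (fst p)) (\<phi> (snd p)))"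
      by (intro continuous_on_dist continuous_on_compose2[OF c\<phi>] continuous_intros) (use ab in auto)
    have X: "compact ?X" by (intro compact_Times) auto
    have D1: "closed (?X \<inter> (\<lambda>p. dist (\<phi> (fst p)) (\<phi> (snd p))) -` {0})"
      by (rule continuous_closed_preimage[OF cX]) (auto intro: closed_Times)
    have D2: "closed {p::real\<times>real. fst p + \<epsilon> \<le> snd p}"
      by (intro closed_Collect_le continuous_intros)
    have "compact (?X \<inter> (\<lambda>p. dist (\<phi> (fst p)) (\<phi> (snd p))) -` {0})"
      using closed_Int_compact[OF D1 X] by (simp add: Int_ac)
    then have "compact ?D" using D2 by (rule compact_Int_closed)
    moreover have "(a, b) \<in> ?D" using near[of a b] ab by (force simp: dist_real_def)
    moreover have "continuous_on ?D (\<lambda>p. snd p - fst p)" by (intro continuous_intros)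
    ultimately obtain p where p: "p \<in> ?D" "\<forall>q\<in>?D. snd p - fst p \<le> snd q - fst q"
      using continuous_attains_inf[of ?D "\<lambda>p. snd p - fst p"] by blast
    obtain s t where [simp]: "p = (s, t)" by force
    have st: "s \<in> {a..b}" "t \<in> {a..b}" "\<phi> s = \<phi> t" "s + \<epsilon> \<le> t" using p(1) by auto
    have min: "t - s \<le> t' - s'" if "s' \<in> {a..b}" "t' \<in> {a..b}" "\<phi> s' = \<phi> t'" "s' + \<epsilon> \<le> t'" for s' t'
      using p(2)[rule_format, of "(s', t')"] that by auto
    have gap: "s' = t'" if "s' \<in> {s..<t}" "t' \<in> {s..<t}" "\<phi> s' = \<phi> t'" "s' \<le> t'" for s' t'
    proof (rule ccontr)
      assume ne: "s' \<noteq> t'"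
      have in': "s' \<in> {a..b}" "t' \<in> {a..b}" using that st by auto
      have "s' + \<epsilon> \<le> t'" using near[OF in' that(3)] ne that(4) by (force simp: dist_real_def)
      from min[OF in' that(3) this] show False using that by auto
    qed
    have "inj_on \<phi> {s..<t}"
      by (rule inj_onI) (metis gap nle_le)
    then show False using no_cycle[of s t] st ab \<epsilon>(1) by auto
  qed
  have left: False if t: "0 < t" "t < 1" "\<phi> 0 = \<phi> t" for t
  proof -
    have gap: "u = v" if "u \<in> {0..<t}" "v \<in> {0..<t}" "\<phi> u = \<phi> v" "u \<le> v" for u v
      using inner[of u v] inner[of v t] that t by force
    have "inj_on \<phi> {0..<t}" by (rule inj_onI) (metis gap nle_le)
    then show False using no_cycle[of 0 t] t by auto
  qed
  have right: False if s: "0 \<le> s" "s < 1" "\<phi> s = \<phi> 1" for s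
  proof -
    have gap: "u = v" if "u \<in> {s..<1}" "v \<in> {s..<1}" "\<phi> u = \<phi> v" "u \<le> v" for u v
    proof (rule ccontr)
      assume "u \<noteq> v"
      then have "u < v" "v < 1" "0 \<le> u" using that s by auto
      then show False using inner[of u v] left[of v] that(3) by (cases "u = 0") auto
    qed
    have "inj_on \<phi> {s..<1}" by (rule inj_onI) (metis gap nle_le)
    then show False using no_cycle[of s 1] s by auto
  qed
  have gap: "u = v" if "u \<in> {0..1}" "v \<in> {0..1}" "\<phi> u = \<phi> v" "u \<le> v" for u v
  proof (rule ccontr)
    assume "u \<noteq> v"
    then have "u < v" "v \<le> 1" "0 \<le> u" using that by auto
    then show False using inner[of u v] left[of v] right[of u] that(3) by (cases "u = 0"; cases "v = 1") auto
  qed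
  have "inj_on \<phi> {0..1}" by (rule inj_onI) (metis gap nle_le)
  then show ?thesis unfolding g(5) inj_on_def \<phi>_def by auto
qed auto

lemma image_seg:
  fixes f :: "'a \<Rightarrow> 'a"
  assumes "continuous_on (seg x y) f" "f ` seg x y \<subseteq> T" "x \<in> T" "y \<in> T" "inj_on f (seg x y)"
  shows "f ` seg x y = seg (f x) (f y)"
proof (cases "x = y")
  case False
  then show ?thesis
    using arc_between_image[OF seg_arc(1)[OF assms(3,4)]] assms by (intro seg_eqI[symmetric]) auto
qed auto

text \<open>In a parameter of \<open>seg p q\<close> the map starts above the diagonal, as
  \<open>p\<close> goes to the far end \<open>q\<close>, and at \<open>y\<close> it is on or below
  it; the intermediate value theorem applies.\<close>

lemma seg_fixed_point:
  fixes g :: "'a \<Rightarrow> 'a"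
  assumes "p \<in> T" "q \<in> T" "y \<in> seg p q" "continuous_on (seg p y) g" "g ` seg p y \<subseteq> seg p q"
    "g p = q" "g y \<in> seg p y"
  shows "\<exists>u\<in>seg p y. g u = u"
proof (cases "y = p")
  case True then show ?thesis using assms by auto
next
  case False
  then have "p \<noteq> q" using assms by auto
  obtain h where h: "continuous_on {0..1} h" "inj_on h {0..1}" "h 0 = p" "h 1 = q" "seg p q = h ` {0..1::real}"
    using arc_betweenE[OF seg_arc(1)[OF assms(1,2) \<open>p \<noteq> q\<close>]] .
  obtain k where k: "homeomorphism {0..1} (h ` {0..1}) h k"
    using homeomorphism_compact[OF _ h(1) refl h(2)] by auto
  then have ck: "continuous_on (seg p q) k" and kh: "\<And>t. t \<in> {0..1} \<Longrightarrow> k (h t) = t"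
    and hk: "\<And>u. u \<in> seg p q \<Longrightarrow> h (k u) = u" using h(5) by (auto simp: homeomorphism_def)
  obtain t where t: "t \<in> {0..1}" "y = h t" using assms(3) h(5) by auto
  have "0 < t" using t h(3) False by (cases "t = 0") auto
  have "seg p y = h ` {0..t}"
    using arc_between_subinterval[OF h(1,2), of 0 t] t \<open>0 < t\<close> h(3,5) seg_subset[OF assms(1,2)]
    by (intro seg_eqI) auto
  then have sy: "h s \<in> seg p y" if "s \<in> {0..t}" for s using that by auto
  have "continuous_on {0..t} (\<lambda>s. k (g (h s)) - s)"
  proof (intro continuous_intros continuous_on_compose2[OF ck] continuous_on_compose2[OF assms(4)])
    show "continuous_on {0..t} h" using continuous_on_subset[OF h(1)] t by auto
  qed (use sy assms(5) in auto)
  moreover have "k (g (h 0)) - 0 \<ge> 0" using kh[of 1] h assms(6) by auto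
  moreover have "k (g (h t)) - t \<le> 0"
  proof -
    obtain s where "s \<in> {0..t}" "g y = h s" using assms(7) \<open>seg p y = h ` {0..t}\<close> by auto
    then show ?thesis using kh[of s] t by auto
  qed
  ultimately obtain s where s: "0 \<le> s" "s \<le> t" "k (g (h s)) - s = 0"
    using IVT2'[of "\<lambda>s. k (g (h s)) - s" t 0 0] \<open>0 < t\<close> by auto
  have "g (h s) \<in> seg p q" using sy[of s] s assms(5) by auto
  then have "g (h s) = h s" using hk s(3) by force
  then show ?thesis using sy[of s] s by auto
qed

end

section \<open>Itineraries and precritical points in Hubbard trees\<close>

lemma finite_orb:
  assumes "periodic_point f x"
  shows "finite (orb f x)"
proof -
  obtain n where n: "n > 0" "(f ^^ n) x = x" using assms periodic_point_def by metis
  have "(f ^^ i) x \<in> (\<lambda>i. (f ^^ i) x) ` {..<n}" for i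
  proof -
    have "(f ^^ i) x = (f ^^ (i mod n)) x" using funpow_mod_eq[OF n(2)] by metis
    then show ?thesis using n by auto
  qed
  then have "orb f x \<subseteq> (\<lambda>i. (f ^^ i) x) ` {..<n}" by (auto simp: orb_def)
  then show ?thesis using finite_subset by blast
qed

lemma orb_refl: "x \<in> orb f x"
  unfolding orb_def by (rule range_eqI[of _ _ 0]) simp

lemma orb_funpow: "y \<in> orb f x \<Longrightarrow> (f ^^ i) y \<in> orb f x"
  unfolding orb_def using funpow_add[of i _ f] by (auto simp: o_def) (metis rangeI)

lemma orb_step: "y \<in> orb f x \<Longrightarrow> f y \<in> orb f x"
  using orb_funpow[of y f x 1] by simp

lemma orb_periodic_back:
  assumes "periodic_point f x" "y \<in> orb f x"
  obtains i where "(f ^^ i) y = x"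
proof -
  obtain n where n: "n > 0" "(f ^^ n) x = x" using assms periodic_point_def by metis
  obtain j where j: "y = (f ^^ j) x" using assms by (auto simp: orb_def)
  have 1: "(f ^^ (n * k)) x = x" for k
  proof (induction k)
    case (Suc k)
    then show ?case using n by (simp add: funpow_add add.commute)
  qed simp
  \<comment> \<open>Since \<open>n > 0\<close>, \<open>j \<le> n * j\<close> and the subtraction is
    not truncated.\<close>
  have "(f ^^ (n * j - j)) y = (f ^^ (n * j)) x"
    using n j funpow_add[of "n * j - j" j f] by simp
  then show ?thesis using that 1 by metis
qed

lemma periodic_funpow:
  assumes "periodic_point f x"
  shows "periodic_point f ((f ^^ i) x)"
proof -
  obtain n where n: "n > 0" "(f ^^ n) x = x" using assms periodic_point_def by metis
  have "(f ^^ n) ((f ^^ i) x) = (f ^^ i) ((f ^^ n) x)"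
    by (metis add.commute comp_apply funpow_add)
  then show ?thesis unfolding periodic_point_def using n by auto
qed

lemma stream_eqI:
  assumes "\<And>i. s !! i = t !! i"
  shows "s = t"
  using assms
proof (coinduction arbitrary: s t)
  case Eq_stream
  then show ?case by (metis snth.simps)
qed

lemma snth_itinerary: "itinerary T f c0 z !! i = position T f c0 ((f ^^ i) z)"
  by (simp add: itinerary_def)

section \<open>Arcs under the iterates of a minimal Hubbard tree\<close>

locale min_hubbard_tree =
  fixes T :: "'a::metric_space set" and f :: "'a \<Rightarrow> 'a" and c0 :: 'a
  assumes min_hubbard: "minimal_hubbard_tree T f c0"
begin

lemma hubbard: "hubbard_tree T f c0"
  using min_hubbard minimal_hubbard_tree_def by auto

sublocale tree T
  using hubbard by unfold_locales (auto simp: hubbard_tree_def)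

lemma cont_f: "continuous_on T f" and image_f: "f ` T = T" and c0_T: "c0 \<in> T"
  and finite_fibre: "y \<in> T \<Longrightarrow> finite {x\<in>T. f x = y}"
  and card_fibre: "y \<in> T \<Longrightarrow> card {x\<in>T. f x = y} \<le> 2"
  and locally_inj: "x \<in> T \<Longrightarrow> x \<noteq> c0 \<Longrightarrow> \<exists>U. openin (top_of_set T) U \<and> x \<in> U \<and> inj_on f U"
  and endpoint_orb: "endpoint T x \<Longrightarrow> x \<in> orb f c0"
  and periodic_c0: "periodic_point f c0"
  using hubbard unfolding hubbard_tree_def by auto

lemma f_T: "x \<in> T \<Longrightarrow> f x \<in> T"
  using image_f by auto

lemma funpow_T: "x \<in> T \<Longrightarrow> (f ^^ i) x \<in> T"
  by (induction i) (auto intro: f_T)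

lemma orb_T: "x \<in> T \<Longrightarrow> orb f x \<subseteq> T"
  by (auto simp: orb_def intro: funpow_T)

lemma cont_funpow: "continuous_on T (f ^^ i)"
proof (induction i)
  case (Suc i)
  then show ?case
    by (auto intro!: continuous_on_compose2[OF cont_f] funpow_T simp: o_def)
qed (simp add: id_def)

lemma finite_funpow_fibre: "finite {u\<in>T. (f ^^ i) u = y}"
proof (induction i)
  case 0
  have "{u \<in> T. (f ^^ 0) u = y} \<subseteq> {y}" by auto
  then show ?case using finite_subset by blast
next
  case (Suc i)
  have "{u\<in>T. (f ^^ Suc i) u = y} = (\<Union>v\<in>{v\<in>T. (f ^^ i) v = y}. {u\<in>T. f u = v})"
    using f_T by (auto simp: funpow_Suc_right simp del: funpow.simps)
  then show ?case using Suc finite_fibre by auto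
qed

text \<open>The ends of the arc are exempt, so that it may start or stop at a precritical point and
  still be mapped injectively by \<open>f ^^ r\<close>.\<close>

definition free :: "nat \<Rightarrow> 'a \<Rightarrow> 'a \<Rightarrow> bool" where
  "free r p q \<longleftrightarrow> (\<forall>i<r. \<forall>u\<in>seg p q. u \<noteq> p \<longrightarrow> u \<noteq> q \<longrightarrow> (f ^^ i) u \<noteq> c0)"

lemma inj_f_seg:
  assumes "p \<in> T" "q \<in> T" "\<And>u. u \<in> seg p q \<Longrightarrow> u \<noteq> p \<Longrightarrow> u \<noteq> q \<Longrightarrow> u \<noteq> c0"
  shows "inj_on f (seg p q)" "f ` seg p q = seg (f p) (f q)"
proof -
  show i: "inj_on f (seg p q)"
    by (rule inj_on_seg[OF cont_f _ assms(1,2)])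
      (use image_f assms locally_inj seg_in_T in auto)
  show "f ` seg p q = seg (f p) (f q)"
    by (rule image_seg[OF _ _ assms(1,2) i])
      (use seg_subset[OF assms(1,2)] cont_f f_T in \<open>auto intro: continuous_on_subset\<close>)
qed

lemma free_inj:
  assumes "p \<in> T" "q \<in> T" "free r p q"
  shows "inj_on (f ^^ r) (seg p q)" "(f ^^ r) ` seg p q = seg ((f ^^ r) p) ((f ^^ r) q)"
proof -
  have "inj_on (f ^^ r) (seg p q) \<and> (f ^^ r) ` seg p q = seg ((f ^^ r) p) ((f ^^ r) q)"
    using assms(3)
  proof (induction r)
    case (Suc r)
    have IH: "inj_on (f ^^ r) (seg p q)" "(f ^^ r) ` seg p q = seg ((f ^^ r) p) ((f ^^ r) q)"
      using Suc unfolding free_def by auto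
    have "v \<noteq> c0" if v: "v \<in> seg ((f ^^ r) p) ((f ^^ r) q)" "v \<noteq> (f ^^ r) p" "v \<noteq> (f ^^ r) q" for v
    proof -
      obtain u where "u \<in> seg p q" "v = (f ^^ r) u" using IH(2) v(1) by (metis imageE)
      moreover have "u \<noteq> p" "u \<noteq> q" using v(2,3) \<open>v = (f ^^ r) u\<close> by auto
      ultimately show ?thesis using Suc.prems[unfolded free_def, rule_format, of r u] by simp
    qed
    then have "inj_on f ((f ^^ r) ` seg p q)"
      "f ` (f ^^ r) ` seg p q = seg (f ((f ^^ r) p)) (f ((f ^^ r) q))"
      using inj_f_seg[of "(f ^^ r) p" "(f ^^ r) q"] funpow_T assms IH(2) by auto
    then have "inj_on (f \<circ> f ^^ r) (seg p q)"
      "(f \<circ> f ^^ r) ` seg p q = seg (f ((f ^^ r) p)) (f ((f ^^ r) q))"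
      using comp_inj_on[OF IH(1)] by (simp_all only: image_comp)
    then show ?case by (simp add: o_def)
  qed auto
  then show "inj_on (f ^^ r) (seg p q)" "(f ^^ r) ` seg p q = seg ((f ^^ r) p) ((f ^^ r) q)" by auto
qed

lemma free_mono: "free r p q \<Longrightarrow> r' \<le> r \<Longrightarrow> free r' p q"
  unfolding free_def by auto

lemma free_sym: "free r p q \<Longrightarrow> p \<in> T \<Longrightarrow> q \<in> T \<Longrightarrow> free r q p"
  unfolding free_def using seg_sym by blast

lemma free_sub:
  assumes "p \<in> T" "q \<in> T" "free r p q" "u \<in> seg p q"
  shows "free r p u"
  unfolding free_def
proof (intro allI impI ballI)
  fix i v assume i: "i < r" and v: "v \<in> seg p u" "v \<noteq> p" "v \<noteq> u"
  have uT: "u \<in> T" using seg_in_T assms by blast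
  have vq: "v \<in> seg p q" using v assms seg_trans by blast
  have "v \<noteq> q" using v seg_antisym[of p u q] assms uT by blast
  then show "(f ^^ i) v \<noteq> c0" using assms(3) i v vq unfolding free_def by blast
qed

lemma free_join:
  assumes "p \<in> T" "q \<in> T" "u \<in> seg p q" "free r p u" "free r u q" "\<And>i. i < r \<Longrightarrow> (f ^^ i) u \<noteq> c0"
  shows "free r p q"
  unfolding free_def using seg_split(1)[OF assms(1-3)] assms(4-6) unfolding free_def by (metis UnE)

section \<open>Itineraries along an arc\<close>

lemma position_eqI:
  assumes "connected_component (T - {c0}) x y"
  shows "position T f c0 x = position T f c0 y"
proof -
  have "x \<noteq> c0" "y \<noteq> c0" using connected_component_in[OF assms] by auto
  moreover have "x \<in> T1_part T f c0 \<longleftrightarrow> y \<in> T1_part T f c0"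
    unfolding T1_part_def using assms
    by (metis connected_component_sym connected_component_trans mem_Collect_eq)
  ultimately show ?thesis by (simp add: position_def)
qed

lemma position_funpow_eq:
  assumes "p \<in> T" "q \<in> T" "\<And>u. u \<in> seg p q \<Longrightarrow> (f ^^ i) u \<noteq> c0"
  shows "position T f c0 ((f ^^ i) p) = position T f c0 ((f ^^ i) q)"
proof (rule position_eqI)
  have "connected ((f ^^ i) ` seg p q)"
    using seg_connected assms cont_funpow continuous_on_subset seg_subset
    by (metis connected_continuous_image)
  moreover have "(f ^^ i) ` seg p q \<subseteq> T - {c0}"
    using assms funpow_T seg_in_T by blast
  ultimately show "connected_component (T - {c0}) ((f ^^ i) p) ((f ^^ i) q)"
    unfolding connected_component_def using seg_ends[OF assms(1,2)] by blast
qed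

text \<open>An arc whose iterates all miss \<open>c0\<close> has one itinerary throughout, and
  minimality allows an itinerary only one periodic point. Several contradictions below end
  here.\<close>

lemma never_hit_imp_eq:
  assumes "p \<in> T" "q \<in> T" "periodic_point f p" "periodic_point f q"
    and "\<And>i u. u \<in> seg p q \<Longrightarrow> (f ^^ i) u \<noteq> c0"
  shows "p = q"
proof (rule ccontr)
  assume "p \<noteq> q"
  have "itinerary T f c0 p = itinerary T f c0 q"
    by (rule stream_eqI) (use position_funpow_eq assms in \<open>simp add: snth_itinerary\<close>)
  then show False using min_hubbard assms \<open>p \<noteq> q\<close> unfolding minimal_hubbard_tree_def by blast
qed

text \<open>Cutting both sides of an arc through \<open>b\<close> at \<open>c0\<close> makes \<open>f\<close> injective on it.\<close>

lemma image_between: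
  assumes T: "x \<in> T" "y \<in> T" and b: "b \<in> seg x y" "b \<noteq> c0"
    and x': "x' = (if c0 \<in> seg b x then c0 else x)" and y': "y' = (if c0 \<in> seg b y then c0 else y)"
  shows "f b \<in> seg (f x') (f y')" "x \<noteq> b \<Longrightarrow> f x' \<noteq> f b" "y \<noteq> b \<Longrightarrow> f y' \<noteq> f b"
proof -
  have bT: "b \<in> T" using b seg_in_T T by blast
  have T': "x' \<in> T" "y' \<in> T" using x' y' T c0_T by auto
  have in': "x' \<in> seg b x" "y' \<in> seg b y" using x' y' seg_ends bT T by auto
  have sub: "seg b x' \<subseteq> seg b x" "seg b y' \<subseteq> seg b y" using seg_mono in' bT T by auto
  have "seg x' b \<inter> seg b y' \<subseteq> {b}"
    using seg_split(2)[OF T b(1)] sub seg_sym[OF bT] T T' by auto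
  then have b': "b \<in> seg x' y'" using seg_join bT T' by auto
  have "u \<noteq> c0" if "u \<in> seg x' y'" "u \<noteq> x'" "u \<noteq> y'" for u
  proof
    assume "u = c0"
    then have "c0 \<in> seg b x \<or> c0 \<in> seg b y"
      using seg_split(1)[OF T' b'] that(1) sub seg_sym[OF bT T'(1)] by blast
    then show False using that \<open>u = c0\<close> x' y' by auto
  qed
  from inj_f_seg[OF T' this] have inj: "inj_on f (seg x' y')" and "f ` seg x' y' = seg (f x') (f y')" by auto
  then show "f b \<in> seg (f x') (f y')" using b' by blast
  have ends: "x' \<in> seg x' y'" "y' \<in> seg x' y'" using seg_ends T' by auto
  show "f x' \<noteq> f b" if "x \<noteq> b" using inj_onD[OF inj _ ends(1) b'] that x' b(2) by (auto split: if_splits)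
  show "f y' \<noteq> f b" if "y \<noteq> b" using inj_onD[OF inj _ ends(2) b'] that y' b(2) by (auto split: if_splits)
qed

text \<open>Each of the three points that \<open>c0\<close> cuts off from \<open>b\<close> is
  replaced by \<open>c0\<close>, which also belongs to \<open>F\<close>; then
  \<open>image_between\<close> applies to the three arcs through \<open>b\<close>. For
  \<open>b = c0\<close>, the image lies in \<open>F\<close> and is the median of itself taken three
  times.\<close>

lemma medians_invariant:
  assumes F: "F \<subseteq> T" "c0 \<in> F" "f ` F \<subseteq> F"
    and b: "\<exists>x\<in>F. \<exists>y\<in>F. \<exists>w\<in>F. is_median b x y w"
  shows "\<exists>x\<in>F. \<exists>y\<in>F. \<exists>w\<in>F. is_median (f b) x y w"
proof (cases "b = c0")
  case True
  have "is_median (f b) (f b) (f b) (f b)" by (simp add: is_median_def)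
  then show ?thesis using True F by blast
next
  case False
  obtain x y w where xyw: "x \<in> F" "y \<in> F" "w \<in> F" "is_median b x y w" using b by auto
  define t where "t a = (if c0 \<in> seg b a then c0 else a)" for a
  have tF: "f (t a) \<in> F" if "a \<in> F" for a using that F by (auto simp: t_def)
  have "is_median (f b) (f (t x)) (f (t y)) (f (t w))"
    using image_between(1)[OF _ _ _ False t_def t_def] xyw F unfolding is_median_def by blast
  then show ?thesis using tF xyw by blast
qed

text \<open>If \<open>f c0\<close> were an inner point of some arc, all its iterates would be:
  \<open>f\<close> preserves inner points off \<open>c0\<close> by injectivity on a cut arc, and at
  \<open>c0\<close> by this assumption. But an endpoint exists and lies on the critical
  orbit.\<close>

lemma critical_value_extremal:
  assumes "f c0 \<noteq> c0" "x \<in> T" "y \<in> T" "f c0 \<in> seg x y"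
  shows "f c0 = x \<or> f c0 = y"
proof (rule ccontr)
  assume ne: "\<not> (f c0 = x \<or> f c0 = y)"
  define inner where "inner p \<longleftrightarrow> (\<exists>x\<in>T. \<exists>y\<in>T. p \<in> seg x y \<and> p \<noteq> x \<and> p \<noteq> y)" for p
  have c1: "inner (f c0)" using ne assms inner_def by blast
  have step: "inner (f p)" if p: "inner p" for p
  proof (cases "p = c0")
    case True then show ?thesis using c1 by auto
  next
    case False
    obtain x y where xy: "x \<in> T" "y \<in> T" "p \<in> seg x y" "p \<noteq> x" "p \<noteq> y" using p inner_def by auto
    define t where "t a = (if c0 \<in> seg p a then c0 else a)" for a
    have "f (t x) \<in> T" "f (t y) \<in> T" using xy f_T c0_T by (auto simp: t_def)
    then show ?thesis using image_between[OF xy(1-3) False t_def t_def] xy(4,5) inner_def by metis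
  qed
  have all: "inner ((f ^^ Suc i) c0)" for i by (induction i) (use c1 step in auto)
  obtain e where e: "endpoint T e" "\<And>x y. x \<in> T \<Longrightarrow> y \<in> T \<Longrightarrow> e \<in> seg x y \<Longrightarrow> e = x \<or> e = y"
    using endpoint_exists[of c0 "f c0"] assms(1) c0_T f_T by metis
  obtain n where n: "n > 0" "(f ^^ n) c0 = c0" using periodic_c0 periodic_point_def by metis
  obtain i where i: "e = (f ^^ i) c0" using endpoint_orb[OF e(1)] by (auto simp: orb_def)
  have "inner e"
  proof (cases i)
    \<comment> \<open>Here \<open>e = c0\<close>, which periodicity turns into a positive iterate,
      covered by \<open>all\<close>.\<close>
    case 0
    obtain k where "n = Suc k" using n(1) by (cases n) auto
    then show ?thesis using all[of k] 0 i n by auto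
  qed (use all i in auto)
  then show False using e(2) inner_def by blast
qed

text \<open>Each side of \<open>c0\<close> would be mapped injectively onto an arc leaving
  \<open>f c0\<close>. As \<open>f c0\<close> is extremal, three such arcs share an initial piece,
  and a point \<open>b2\<close> on it has three preimages.\<close>

lemma not_three_sides:
  assumes "f c0 \<noteq> c0" "p \<in> T" "q \<in> T" "r \<in> T" "p \<noteq> c0" "q \<noteq> c0" "r \<noteq> c0"
    "c0 \<in> seg p q" "c0 \<in> seg p r" "c0 \<in> seg q r"
  shows False
proof -
  let ?c1 = "f c0"
  have c1T: "?c1 \<in> T" using f_T c0_T by auto
  have arm: "f a \<noteq> ?c1 \<and> f ` seg c0 a = seg ?c1 (f a)" if "a \<in> T" "a \<noteq> c0" for a
  proof -
    have 1: "inj_on f (seg c0 a)" "f ` seg c0 a = seg ?c1 (f a)" by (rule inj_f_seg; use c0_T that in auto)+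
    then have "f a \<noteq> ?c1" using inj_onD[OF 1(1), of a c0] seg_ends[OF c0_T that(1)] that(2) by auto
    then show ?thesis using 1 by auto
  qed
  note a = arm[OF assms(2,5)] arm[OF assms(3,6)] arm[OF assms(4,7)]
  have fT: "f p \<in> T" "f q \<in> T" "f r \<in> T" using f_T assms by auto
  obtain b1 where b1: "b1 \<in> seg ?c1 (f p)" "b1 \<in> seg (f p) (f q)" "b1 \<in> seg ?c1 (f q)"
    using median_exists[OF c1T fT(1,2)] by blast
  have b1T: "b1 \<in> T" using b1 seg_in_T c1T fT by blast
  have "b1 \<noteq> ?c1" using critical_value_extremal[OF assms(1) fT(1,2)] b1 a by auto
  obtain b2 where b2: "b2 \<in> seg ?c1 b1" "b2 \<in> seg b1 (f r)" "b2 \<in> seg ?c1 (f r)"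
    using median_exists[OF c1T b1T fT(3)] by blast
  have b2T: "b2 \<in> T" using b2 seg_in_T c1T fT by blast
  have "b2 \<noteq> ?c1" using critical_value_extremal[OF assms(1) b1T fT(3)] b2 a \<open>b1 \<noteq> ?c1\<close> by auto
  have "b2 \<in> seg ?c1 (f p)" "b2 \<in> seg ?c1 (f q)" using seg_trans b1 b2 c1T fT by blast+
  then have "b2 \<in> f ` seg c0 p" "b2 \<in> f ` seg c0 q" "b2 \<in> f ` seg c0 r" using a b2(3) by simp_all
  then obtain u v w where uvw: "u \<in> seg c0 p" "v \<in> seg c0 q" "w \<in> seg c0 r" "f u = b2" "f v = b2" "f w = b2"
    by (metis imageE)
  have T: "u \<in> T" "v \<in> T" "w \<in> T" using uvw seg_in_T c0_T assms by blast+
  have "u \<noteq> c0" "v \<noteq> c0" "w \<noteq> c0" using uvw \<open>b2 \<noteq> ?c1\<close> by auto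
  then have "u \<noteq> v" "u \<noteq> w" "v \<noteq> w"
    using uvw seg_split(2)[OF assms(2,3,8)] seg_split(2)[OF assms(2,4,9)] seg_split(2)[OF assms(3,4,10)]
      seg_sym[OF c0_T assms(2)] seg_sym[OF c0_T assms(3)] by blast+
  then have "card {u, v, w} = 3" by simp
  moreover have "{u, v, w} \<subseteq> {x\<in>T. f x = b2}" using uvw T by auto
  then have "card {u, v, w} \<le> card {x\<in>T. f x = b2}"
    using card_mono[OF finite_fibre[OF b2T]] by blast
  ultimately show False using card_fibre[OF b2T] by linarith
qed

text \<open>\<open>c0\<close> separates \<open>f c0\<close> from at least one of \<open>x\<close>
  and \<open>y\<close> by the triangle inclusion, and from at most one by
  \<open>not_three_sides\<close>.\<close>

lemma position_flip:
  assumes "f c0 \<noteq> c0" "x \<in> T" "y \<in> T" "x \<noteq> c0" "y \<noteq> c0" "c0 \<in> seg x y"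
  shows "position T f c0 y = flip (position T f c0 x)"
proof -
  have c1T: "f c0 \<in> T" using f_T c0_T by auto
  have "x \<in> T1_part T f c0 \<longleftrightarrow> c0 \<notin> seg (f c0) x" "y \<in> T1_part T f c0 \<longleftrightarrow> c0 \<notin> seg (f c0) y"
    unfolding T1_part_def using connected_component_iff[OF c0_T c1T] assms by auto
  moreover have "c0 \<in> seg (f c0) x \<or> c0 \<in> seg (f c0) y"
    using seg_triangle[of x y "f c0"] seg_sym[of x "f c0"] assms c1T by auto
  moreover have "\<not> (c0 \<in> seg (f c0) x \<and> c0 \<in> seg (f c0) y)"
    using not_three_sides[of "f c0" x y] assms c1T by auto
  ultimately show ?thesis using assms by (auto simp: position_def)
qed

text \<open>Lying in different components of the complement of \<open>w\<close> means being
  separated by \<open>w\<close> along an arc. So the two components in the definition become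
  betweenness: \<open>w\<close> separates \<open>c0\<close> from \<open>f c0\<close>, but not from
  the other points of its orbit.\<close>

lemma characteristic_iff:
  assumes "w \<in> T" "w \<noteq> f c0"
  shows "characteristic_point T f c0 w \<longleftrightarrow> periodic_point f w \<and> orb f w \<inter> orb f c0 = {} \<and>
    w \<in> seg c0 (f c0) \<and> (\<forall>i. (f ^^ i) w = w \<or> w \<notin> seg c0 ((f ^^ i) w))"
proof
  have c1T: "f c0 \<in> T" using f_T c0_T by auto
  { assume "characteristic_point T f c0 w"
    then obtain C D where w: "periodic_point f w" "orb f w \<inter> orb f c0 = {}"
      and CD: "C \<in> components (T - {w})" "D \<in> components (T - {w})" "C \<noteq> D" "f c0 \<in> C" "c0 \<in> D"
        "orb f w - {w} \<subseteq> D"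
      using assms unfolding characteristic_point_def by auto
    have comp: "E = connected_component_set (T - {w}) x" if "E \<in> components (T - {w})" "x \<in> E" for E x
      using that connected_component_eq components_iff by metis
    have "w \<noteq> c0" using w(2) orb_refl[of c0 f] by auto
    have "\<not> connected_component (T - {w}) c0 (f c0)"
      using comp[OF CD(1,4)] comp[OF CD(2,5)] CD(3) connected_component_eq by (metis mem_Collect_eq)
    then have "w \<in> seg c0 (f c0)"
      using connected_component_iff[of w c0 "f c0"] assms c0_T c1T \<open>w \<noteq> c0\<close> by auto
    moreover have "(f ^^ i) w = w \<or> w \<notin> seg c0 ((f ^^ i) w)" for i
    proof (cases "(f ^^ i) w = w")
      case False
      then have "(f ^^ i) w \<in> D" using CD(6) unfolding orb_def by blast
      then have "connected_component (T - {w}) c0 ((f ^^ i) w)" using comp[OF CD(2,5)] by auto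
      then show ?thesis using connected_component_iff[of w c0 "(f ^^ i) w"] assms c0_T funpow_T False \<open>w \<noteq> c0\<close> by auto
    qed auto
    ultimately show "periodic_point f w \<and> orb f w \<inter> orb f c0 = {} \<and>
      w \<in> seg c0 (f c0) \<and> (\<forall>i. (f ^^ i) w = w \<or> w \<notin> seg c0 ((f ^^ i) w))" using w by auto }
  { assume w: "periodic_point f w \<and> orb f w \<inter> orb f c0 = {} \<and>
      w \<in> seg c0 (f c0) \<and> (\<forall>i. (f ^^ i) w = w \<or> w \<notin> seg c0 ((f ^^ i) w))"
    then have "w \<noteq> c0" using orb_refl[of c0 f] by auto
    let ?C = "connected_component_set (T - {w}) (f c0)" and ?D = "connected_component_set (T - {w}) c0"
    have mem: "f c0 \<in> ?C" "c0 \<in> ?D" using assms c1T c0_T \<open>w \<noteq> c0\<close> by auto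
    have "f c0 \<notin> ?D" using connected_component_iff[of w c0 "f c0"] assms w c0_T c1T \<open>w \<noteq> c0\<close> by auto
    then have "?C \<noteq> ?D" using mem by blast
    moreover have "?C \<in> components (T - {w})" "?D \<in> components (T - {w})"
      using assms(2) c1T c0_T \<open>w \<noteq> c0\<close> by (auto intro!: componentsI)
    moreover have "orb f w - {w} \<subseteq> ?D"
    proof
      fix v assume v: "v \<in> orb f w - {w}"
      then obtain i where i: "v = (f ^^ i) w" by (auto simp: orb_def)
      then have "w \<notin> seg c0 v" using w v by auto
      then show "v \<in> ?D" using connected_component_iff[of w c0 v] assms c0_T funpow_T i v \<open>w \<noteq> c0\<close> by auto
    qed
    ultimately have "\<exists>C\<in>components (T - {w}). \<exists>D\<in>components (T - {w}).
         C \<noteq> D \<and> f c0 \<in> C \<and> c0 \<in> D \<and> orb f w - {w} \<subseteq> D"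
      using mem by (intro bexI[of _ ?C] bexI[of _ ?D] conjI)
    then show "characteristic_point T f c0 w"
      unfolding characteristic_point_def using assms(1) w by simp }
qed

end

section \<open>The return map of the arm towards the critical value\<close>

lemma finite_inj_on_periodic:
  assumes "finite A" "F ` A \<subseteq> A" "inj_on F A" "a \<in> A"
  obtains j where "j > 0" "(F ^^ j) a = a"
proof -
  have A: "(F ^^ i) b \<in> A" if "b \<in> A" for i b using that assms(2) by (induction i) auto
  have inj: "inj_on (F ^^ i) A" for i
  proof (induction i)
    case (Suc i)
    have "inj_on F ((F ^^ i) ` A)" using A by (auto intro: inj_on_subset[OF assms(3)])
    then show ?case using comp_inj_on[OF Suc] by (simp add: o_def)
  qed auto
  have "\<not> inj (\<lambda>i. (F ^^ i) a)"
    using finite_subset[OF _ assms(1), of "range (\<lambda>i. (F ^^ i) a)"] A[OF assms(4)]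
      finite_imageD[of "\<lambda>i. (F ^^ i) a" UNIV] by auto
  then obtain i k where ik: "i < k" "(F ^^ i) a = (F ^^ k) a"
    unfolding inj_def by (metis linorder_neqE_nat)
  have "(F ^^ k) a = (F ^^ i) ((F ^^ (k - i)) a)"
    using ik(1) funpow_add[of i "k - i" F] by simp
  then have "(F ^^ (k - i)) a = a"
    using inj_onD[OF inj[of i], of "(F ^^ (k - i)) a" a] A assms(4) ik(2) by simp
  then show ?thesis using that[of "k - i"] ik(1) by simp
qed

lemma filtermap_funpow:
  fixes h :: "'b \<Rightarrow> 'b"
  shows "(filtermap h ^^ j) L = filtermap (h ^^ j) L"
proof (induction j)
  case (Suc j)
  have "(filtermap h ^^ Suc j) L = filtermap h (filtermap (h ^^ j) L)" using Suc by simp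
  also have "\<dots> = filtermap (h ^^ Suc j) L" by (simp add: filtermap_filtermap o_def)
  finally show ?case .
qed (simp add: filtermap_ident id_def)

section \<open>The characteristic point \<open>z\<close> and its side towards the critical
  value\<close>

locale characteristic_setup = min_hubbard_tree +
  fixes z :: 'a
  assumes z_open: "z \<in> open_arc T c0 (f c0)"
    and z_char: "characteristic_point T f c0 z"
begin

abbreviation c1 :: 'a where "c1 \<equiv> f c0"

definition n :: nat where "n = period f z"

definition Q :: nat where "Q = local_arm_period f z (local_arm T z c1)"

definition m :: nat where "m = Q * n"

abbreviation g :: "'a \<Rightarrow> 'a" where "g \<equiv> f ^^ m"

lemma c1_T: "c1 \<in> T" using c0_T f_T by auto

lemma z_facts: "z \<in> T" "z \<noteq> c0" "z \<noteq> c1" "z \<in> seg c0 c1" "c1 \<noteq> c0"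
proof -
  show "z \<noteq> c0" "z \<noteq> c1" "z \<in> seg c0 c1" using z_open by (auto simp: open_arc_def)
  then show "z \<in> T" using seg_in_T c0_T c1_T by blast
  show "c1 \<noteq> c0" using z_open by (auto simp: open_arc_def)
qed

lemma z_per: "periodic_point f z" and z_orb: "orb f z \<inter> orb f c0 = {}"
  and z_sep: "(f ^^ i) z = z \<or> z \<notin> seg c0 ((f ^^ i) z)"
  using characteristic_iff[OF z_facts(1,3)] z_char by auto

lemma z_not_hit: "(f ^^ i) z \<noteq> c0"
  using z_orb orb_funpow[OF orb_refl, of i f z] orb_refl[of c0 f] by auto

lemma period_z: "n > 0" "(f ^^ n) z = z" "(f ^^ r) z = z \<longleftrightarrow> n dvd r"
proof -
  have "\<exists>k. k > 0 \<and> (f ^^ k) z = z" using z_per periodic_point_def by metis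
  from LeastI_ex[OF this] show n: "n > 0" "(f ^^ n) z = z" by (auto simp: n_def period_def)
  show "(f ^^ r) z = z \<longleftrightarrow> n dvd r"
  proof
    assume "(f ^^ r) z = z"
    then have "(f ^^ (r mod n)) z = z" using funpow_mod_eq[OF n(2)] by metis
    then have "\<not> r mod n > 0"
      using not_less_Least[of "r mod n" "\<lambda>k. k > 0 \<and> (f ^^ k) z = z"] n(1)
      by (auto simp: n_def[unfolded period_def, symmetric])
    then show "n dvd r" by auto
  next
    assume "n dvd r"
    then show "(f ^^ r) z = z" using funpow_mod_eq[OF n(2), of r] by simp
  qed
qed

lemma orb_z_sep:
  assumes "y \<in> orb f z"
  shows "z \<in> seg y c1"
proof -
  obtain i where i: "y = (f ^^ i) z" using assms by (auto simp: orb_def)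
  then have "y \<in> T" using funpow_T z_facts by auto
  then show ?thesis
    using z_sep[of i] i seg_triangle[OF c0_T c1_T \<open>y \<in> T\<close>] z_facts seg_ends[OF z_facts(1) c1_T] by auto
qed

text \<open>The component of \<open>T - {z}\<close> containing \<open>c1\<close>, described by arcs;
  \<open>z\<close> is excluded because it lies on \<open>seg z c1\<close>.\<close>

definition C :: "'a set" where "C = {w\<in>T. z \<notin> seg w c1}"

lemma C_T: "w \<in> C \<Longrightarrow> w \<in> T" by (simp add: C_def)

lemma C_ne: "w \<in> C \<Longrightarrow> w \<noteq> z" using seg_ends[OF z_facts(1) c1_T] by (auto simp: C_def)

lemma c1_C: "c1 \<in> C" using c1_T z_facts by (simp add: C_def)

lemma orb_z_C: "y \<in> orb f z \<Longrightarrow> y \<notin> C"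
  using orb_z_sep by (auto simp: C_def)

lemma not_between:
  assumes "w \<in> T" "u \<in> seg z w" "u \<noteq> z"
  shows "z \<notin> seg u w"
proof -
  have "u \<in> T" using assms seg_in_T z_facts by blast
  then show ?thesis
    using seg_split(2)[OF z_facts(1) assms(1,2)] seg_ends(1)[OF z_facts(1)] assms(3)
    by (metis IntI singletonD)
qed

lemma C_seg: assumes "w \<in> C" "u \<in> seg z w" "u \<noteq> z" shows "u \<in> C"
proof -
  have wT: "w \<in> T" using assms C_T by auto
  then have uT: "u \<in> T" using assms seg_in_T z_facts by blast
  show ?thesis using seg_triangle[OF uT c1_T wT] not_between[OF wT assms(2,3)] assms(1) uT by (auto simp: C_def)
qed

lemma C_beyond: assumes "u \<in> C" "u \<in> seg z w" "w \<in> T" shows "w \<in> C"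
proof -
  have uT: "u \<in> T" and "u \<noteq> z" using assms C_T C_ne by auto
  then show ?thesis
    using seg_triangle[OF assms(3) c1_T uT] not_between[OF assms(3,2)] seg_sym[OF uT assms(3)] assms
    by (auto simp: C_def)
qed

lemma local_arm_C:
  assumes "w \<in> T" "w \<noteq> z"
  shows "local_arm T z w = local_arm T z c1 \<longleftrightarrow> w \<in> C"
  using local_arm_eq_iff[OF z_facts(1) assms(1) c1_T] assms z_facts by (auto simp: C_def)

section \<open>The action of return maps on the local arms at \<open>z\<close>\<close>

lemma finite_hits: "finite {u\<in>T. \<exists>i<r. (f ^^ i) u = c0}"
proof -
  have "{u\<in>T. \<exists>i<r. (f ^^ i) u = c0} = (\<Union>i\<in>{..<r}. {u\<in>T. (f ^^ i) u = c0})" by auto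
  then show ?thesis using finite_funpow_fibre by simp
qed

lemma free_initial:
  assumes "p \<in> T" "p \<noteq> z"
  obtains p' where "p' \<in> seg z p" "p' \<noteq> z" "free r z p'"
proof (cases "{u\<in>T. \<exists>i<r. (f ^^ i) u = c0} \<inter> seg z p = {}")
  case True
  then have "free r z p" unfolding free_def using seg_in_T[of _ z p] z_facts assms by blast
  then show ?thesis using that[of p] seg_ends[OF z_facts(1) assms(1)] assms by auto
next
  case False
  obtain u where u: "u \<in> {u\<in>T. \<exists>i<r. (f ^^ i) u = c0}" "u \<in> seg z p"
    "\<forall>v\<in>{u\<in>T. \<exists>i<r. (f ^^ i) u = c0}. v \<in> seg z u \<longrightarrow> v = u"
    using first_hit[OF z_facts(1) assms(1) finite_hits False] .
  have "free r z u" unfolding free_def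
  proof (intro allI impI ballI notI)
    fix i v assume v: "i < r" "v \<in> seg z u" "v \<noteq> u" "(f ^^ i) v = c0"
    have "v \<in> T" using v u seg_in_T z_facts by blast
    then show False using u(3) v by auto
  qed
  moreover have "u \<noteq> z" using u z_not_hit by auto
  ultimately show ?thesis using that u by auto
qed

text \<open>Pushing an arm forward amounts to following one point \<open>w\<close> on it: the germ
  is represented by the compact arc \<open>seg z w\<close>, on which \<open>f ^^ r\<close> is
  injective.\<close>

lemma arm_image:
  assumes "w \<in> T" "w \<noteq> z" "free r z w" "(f ^^ r) z = z"
  shows "(f ^^ r) w \<noteq> z" "filtermap (f ^^ r) (local_arm T z w) = local_arm T z ((f ^^ r) w)"
proof -
  note i = free_inj[OF z_facts(1) assms(1,3)]
  show ne: "(f ^^ r) w \<noteq> z"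
    using inj_onD[OF i(1), of w z] seg_ends[OF z_facts(1) assms(1)] assms by auto
  have "filtermap (f ^^ r) (at z within seg z w) = at ((f ^^ r) z) within (f ^^ r) ` seg z w"
    by (rule filtermap_germ[OF seg_compact _ i(1)])
      (use z_facts assms seg_ends[OF z_facts(1) assms(1)] continuous_on_subset[OF cont_funpow] seg_subset in auto)
  then show "filtermap (f ^^ r) (local_arm T z w) = local_arm T z ((f ^^ r) w)"
    using local_arm_seg[OF z_facts(1) assms(1,2)] local_arm_seg[OF z_facts(1) funpow_T[OF assms(1)] ne]
      i(2) assms(4) by simp
qed

lemma local_arm_initial:
  assumes "p \<in> T" "p' \<in> seg z p" "p' \<noteq> z"
  shows "local_arm T z p' = local_arm T z p"
proof -
  have "p' \<in> T" "p \<noteq> z" using assms seg_in_T z_facts by auto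
  then show ?thesis using local_arm_eq_iff[OF z_facts(1)] not_between assms by auto
qed

text \<open>\<open>f ^^ n\<close> acts injectively on the finite set of arms at \<open>z\<close>, so
  each arm is periodic. Hence the least number in \<open>local_arm_period\<close> exists.\<close>

lemma local_arm_periodic:
  obtains j where "j > 0" "filtermap (f ^^ (j * n)) (local_arm T z c1) = local_arm T z c1"
proof -
  let ?A = "local_arm T z ` (T - {z})" and ?F = "filtermap (f ^^ n)"
  have short: "\<exists>p'. p' \<in> T \<and> p' \<noteq> z \<and> free n z p' \<and> local_arm T z p = local_arm T z p' \<and>
      ?F (local_arm T z p) = local_arm T z ((f ^^ n) p') \<and> (f ^^ n) p' \<in> T - {z}" if p: "p \<in> T - {z}" for p
  proof -
    obtain p' where p': "p' \<in> seg z p" "p' \<noteq> z" "free n z p'" using free_initial p by blast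
    have "p' \<in> T" using p' p seg_in_T z_facts by blast
    then show ?thesis
      using arm_image[OF \<open>p' \<in> T\<close> p'(2,3) period_z(2)] local_arm_initial[OF _ p'(1,2)] p p' funpow_T by auto
  qed
  have "inj_on ?F ?A"
  proof (rule inj_onI)
    fix A B assume AB: "A \<in> ?A" "B \<in> ?A" "?F A = ?F B"
    then obtain p q where pq: "p \<in> T - {z}" "A = local_arm T z p" "q \<in> T - {z}" "B = local_arm T z q" by blast
    obtain p' where p': "p' \<in> T" "p' \<noteq> z" "free n z p'" "local_arm T z p = local_arm T z p'"
      "?F (local_arm T z p) = local_arm T z ((f ^^ n) p')" "(f ^^ n) p' \<in> T - {z}" using short[OF pq(1)] by blast
    obtain q' where q': "q' \<in> T" "q' \<noteq> z" "free n z q'" "local_arm T z q = local_arm T z q'"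
      "?F (local_arm T z q) = local_arm T z ((f ^^ n) q')" "(f ^^ n) q' \<in> T - {z}" using short[OF pq(3)] by blast
    have "z \<notin> seg ((f ^^ n) p') ((f ^^ n) q')"
      using local_arm_eq_iff[OF z_facts(1), of "(f ^^ n) p'" "(f ^^ n) q'"] p' q' pq AB(3) by auto
    \<comment> \<open>Different arms have \<open>z\<close> between them, and \<open>f ^^ n\<close>
      is injective on the whole arc through \<open>z\<close> because \<open>z\<close> never meets
      \<open>c0\<close>.\<close>
    moreover have "z \<in> seg ((f ^^ n) p') ((f ^^ n) q')" if "z \<in> seg p' q'"
    proof -
      have "free n p' q'"
        using free_join[OF p'(1) q'(1) that free_sym[OF p'(3) z_facts(1) p'(1)] q'(3)] z_not_hit by auto
      from free_inj(2)[OF p'(1) q'(1) this] show ?thesis using period_z(2) that by (metis imageI)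
    qed
    ultimately show "A = B" using local_arm_eq_iff[OF z_facts(1) p'(1) q'(1) p'(2) q'(2)] p' q' pq by auto
  qed
  moreover have "?F ` ?A \<subseteq> ?A"
  proof (rule image_subsetI)
    fix A assume "A \<in> ?A"
    then obtain p where "p \<in> T - {z}" "A = local_arm T z p" by blast
    then show "?F A \<in> ?A" using short[of p] by auto
  qed
  moreover have "local_arm T z c1 \<in> ?A" using c1_T z_facts by auto
  ultimately obtain j where j: "j > 0" "(?F ^^ j) (local_arm T z c1) = local_arm T z c1"
    using finite_inj_on_periodic[OF finite_local_arms[OF z_facts(1)]] by metis
  have "(f ^^ n) ^^ j = f ^^ (j * n)" by (simp add: funpow_mult mult.commute)
  then show ?thesis using that[of j] j by (simp add: filtermap_funpow)
qed

lemma Q_facts: "Q > 0" "filtermap (f ^^ (Q * n)) (local_arm T z c1) = local_arm T z c1"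
  "0 < j \<Longrightarrow> j < Q \<Longrightarrow> filtermap (f ^^ (j * n)) (local_arm T z c1) \<noteq> local_arm T z c1"
proof -
  let ?P = "\<lambda>j. j > 0 \<and> filtermap (f ^^ (j * n)) (local_arm T z c1) = local_arm T z c1"
  have Q: "Q = (LEAST j. ?P j)" by (simp add: Q_def local_arm_period_def n_def)
  have "\<exists>j. ?P j" using local_arm_periodic by metis
  from LeastI_ex[OF this] show "Q > 0" "filtermap (f ^^ (Q * n)) (local_arm T z c1) = local_arm T z c1"
    by (auto simp: Q)
  show "filtermap (f ^^ (j * n)) (local_arm T z c1) \<noteq> local_arm T z c1" if "0 < j" "j < Q"
    using not_less_Least[of j ?P] that by (auto simp: Q)
qed

lemma m_pos: "m > 0" using Q_facts(1) period_z(1) by (simp add: m_def)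

lemma g_z: "g z = z" using period_z(3)[of m] by (simp add: m_def)

lemma return_C:
  assumes "w \<in> C" "free m z w"
  shows "g w \<in> C"
proof -
  have w: "w \<in> T" "w \<noteq> z" using assms C_T C_ne by auto
  note a = arm_image[OF w assms(2) g_z]
  have "local_arm T z (g w) = local_arm T z c1"
    using a(2) local_arm_C[OF w] assms(1) Q_facts(2) by (simp add: m_def)
  then show ?thesis using local_arm_C[OF funpow_T[OF w(1)] a(1)] by simp
qed

text \<open>A return to \<open>z\<close> before time \<open>m = Q * n\<close> happens at some
  \<open>j * n\<close> with \<open>0 < j < Q\<close>, when by minimality of \<open>Q\<close> the arm
  is mapped to a different one.\<close>

lemma early_return_C:
  assumes "w \<in> C" "0 < r" "r < m" "(f ^^ r) z = z" "free r z w"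
  shows "(f ^^ r) w \<notin> C"
proof -
  have w: "w \<in> T" "w \<noteq> z" using assms C_T C_ne by auto
  note a = arm_image[OF w assms(5,4)]
  obtain j where j: "r = j * n" using period_z(3)[of r] assms(4) by (metis dvd_def mult.commute)
  then have "0 < j" "j < Q" using assms(2,3) by (auto simp: m_def)
  from Q_facts(3)[OF this] have "local_arm T z ((f ^^ r) w) \<noteq> local_arm T z c1"
    using a(2) local_arm_C[OF w] assms(1) j by simp
  then show ?thesis using local_arm_C[OF funpow_T[OF w(1)] a(1)] by simp
qed

section \<open>Timing of the first visit to \<open>c0\<close>\<close>

lemma orb_z_after:
  assumes "(f ^^ r) y = z" "r \<le> m"
  shows "g y \<in> orb f z"
proof -
  have "g y = (f ^^ (m - r)) z" using assms funpow_add[of "m - r" r f] by auto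
  then show ?thesis by (simp add: orb_def)
qed

text \<open>A visit to \<open>z\<close> would leave the point at time \<open>m\<close> in the orbit
  of \<open>z\<close>, which misses \<open>C\<close>, whereas \<open>return_C\<close> puts it into
  \<open>C\<close>.\<close>

lemma free_avoids_z:
  assumes "y \<in> C" "free m z y" "r \<le> m"
  shows "(f ^^ r) y \<noteq> z"
  using return_C[OF assms(1,2)] orb_z_after[OF _ assms(3)] orb_z_C by blast

text \<open>At time \<open>Suc i\<close> the arc is mapped onto an arc from an orbit point of
  \<open>z\<close> to \<open>c1\<close>. That orbit point is not \<open>z\<close>, or else
  \<open>w\<close> would have returned to \<open>c1 \<in> C\<close> too early; so \<open>z\<close>
  is inside the image, and \<open>y\<close> is its preimage.\<close>

lemma early_hit:
  assumes "w \<in> C" "Suc i < m" "free (Suc i) z w" "(f ^^ i) w = c0"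
  obtains y where "y \<in> seg z w" "y \<noteq> z" "y \<noteq> w" "(f ^^ Suc i) y = z"
proof -
  have w: "w \<in> T" using assms C_T by auto
  have fw: "(f ^^ Suc i) w = c1" using assms by simp
  have ne: "(f ^^ Suc i) z \<noteq> z"
    using early_return_C[OF assms(1) _ assms(2) _ assms(3)] fw c1_C by auto
  have "z \<in> seg ((f ^^ Suc i) z) c1" using orb_z_sep[OF orb_funpow[OF orb_refl]] .
  then have "z \<in> (f ^^ Suc i) ` seg z w" using free_inj(2)[OF z_facts(1) w assms(3)] fw by simp
  then obtain y where "y \<in> seg z w" "(f ^^ Suc i) y = z" by (metis imageE)
  then show ?thesis using that[of y] ne fw z_facts by metis
qed

definition hit :: "'a \<Rightarrow> bool" where "hit u \<longleftrightarrow> (\<exists>i<m. (f ^^ i) u = c0)"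

lemma free_if_no_hit: "(\<And>u. u \<in> seg p q \<Longrightarrow> u \<noteq> p \<Longrightarrow> u \<noteq> q \<Longrightarrow> \<not> hit u) \<Longrightarrow> free m p q"
  unfolding free_def hit_def by blast

text \<open>A first hit at an earlier time than \<open>m - 1\<close> would make the image of the arc run through \<open>z\<close>,
  and a point mapped to \<open>z\<close> cannot return into \<open>C\<close> at time \<open>m\<close>.\<close>

lemma first_hit_at_end:
  assumes "w \<in> C" "u0 \<in> seg z w" "hit u0"
  obtains x where "x \<in> seg z w" "x \<noteq> z" "x \<in> C" "(f ^^ (m - 1)) x = c0" "free m z x"
    "\<And>i. i < m - 1 \<Longrightarrow> (f ^^ i) x \<noteq> c0"
proof -
  have w: "w \<in> T" using assms C_T by auto
  let ?H = "{u\<in>T. \<exists>i<m. (f ^^ i) u = c0}"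
  have H: "u \<in> ?H \<longleftrightarrow> u \<in> T \<and> hit u" for u by (auto simp: hit_def)
  have "?H \<inter> seg z w \<noteq> {}" using assms H seg_in_T[OF _ z_facts(1) w] by blast
  obtain x where x: "x \<in> ?H" "x \<in> seg z w" "\<forall>v\<in>?H. v \<in> seg z x \<longrightarrow> v = x"
    using first_hit[OF z_facts(1) w finite_hits \<open>?H \<inter> seg z w \<noteq> {}\<close>] .
  have xz: "x \<noteq> z" using x z_not_hit by auto
  have xC: "x \<in> C" using C_seg[OF assms(1) x(2) xz] .
  have xT: "x \<in> T" using xC C_T by auto
  have fr: "free m z x"
  proof (rule free_if_no_hit)
    show "\<not> hit u" if "u \<in> seg z x" "u \<noteq> x" for u
      using x(3) that H seg_in_T[OF _ z_facts(1) xT] by blast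
  qed
  have early: "(f ^^ i) x \<noteq> c0" if "i < m - 1" for i
  proof
    assume hi: "(f ^^ i) x = c0"
    have im: "Suc i < m" using that by auto
    obtain y where y: "y \<in> seg z x" "y \<noteq> z" "(f ^^ Suc i) y = z"
      using early_hit[OF xC im free_mono[OF fr] hi] im by auto
    have "y \<in> C" using C_seg[OF xC y(1,2)] .
    then show False using free_avoids_z[OF _ free_sub[OF z_facts(1) xT fr y(1)], of "Suc i"] y(3) im by auto
  qed
  obtain i where i: "i < m" "(f ^^ i) x = c0" using x(1) by auto
  then have "\<not> i < m - 1" using early by blast
  then have "i = m - 1" using i(1) by linarith
  then show ?thesis using that x(2) xz xC i(2) fr early by blast
qed

text \<open>The branching points needed below are medians of points of these two orbits. All such
  medians together form a finite set invariant under \<open>f\<close>, so none of them has an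
  infinite orbit.\<close>

definition V :: "'a set" where
  "V = {b. \<exists>x\<in>orb f z \<union> orb f c0. \<exists>y\<in>orb f z \<union> orb f c0. \<exists>w\<in>orb f z \<union> orb f c0. is_median b x y w}"

lemma V_finite: "finite V" and V_T: "b \<in> V \<Longrightarrow> b \<in> T" and V_funpow: "b \<in> V \<Longrightarrow> (f ^^ i) b \<in> V"
proof -
  let ?F = "orb f z \<union> orb f c0"
  have F: "finite ?F" "?F \<subseteq> T" "f ` ?F \<subseteq> ?F" "c0 \<in> ?F"
    using finite_orb z_per periodic_c0 orb_T z_facts c0_T orb_step[of _ f] orb_refl[of c0 f] by auto
  show "finite V" unfolding V_def using finite_medians[OF F(1,2)] .
  show "b \<in> T" if "b \<in> V" for b
    using that F(2) seg_in_T unfolding V_def is_median_def by blast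
  have "f b \<in> V" if "b \<in> V" for b
    using medians_invariant[OF F(2,4,3)] that unfolding V_def by simp
  then show "b \<in> V \<Longrightarrow> (f ^^ i) b \<in> V" by (induction i) auto
qed

lemma V_preperiodic:
  assumes "b \<in> V"
  obtains i where "periodic_point f ((f ^^ i) b)"
proof -
  have "\<not> inj (\<lambda>i. (f ^^ i) b)"
    using finite_subset[OF _ V_finite, of "range (\<lambda>i. (f ^^ i) b)"] V_funpow[OF assms]
      finite_imageD[of "\<lambda>i. (f ^^ i) b" UNIV] by auto
  then obtain i k where ik: "i < k" "(f ^^ i) b = (f ^^ k) b"
    unfolding inj_def by (metis linorder_neqE_nat)
  have "(f ^^ (k - i)) ((f ^^ i) b) = (f ^^ i) b"
    using ik funpow_add[of "k - i" i f] by simp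
  then show ?thesis using that[of i] ik(1) unfolding periodic_point_def
    by (metis zero_less_diff)
qed

text \<open>Points of \<open>V\<close> are preperiodic. If \<open>seg z b\<close> never met
  \<open>c0\<close>, it could be moved injectively to a time when the image of \<open>b\<close> is
  periodic, and then its two ends would be periodic points with the same itinerary.\<close>

lemma V_hit:
  assumes "b \<in> V" "b \<noteq> z"
  shows "\<exists>u\<in>seg z b. \<exists>i. (f ^^ i) u = c0"
proof (rule ccontr)
  assume "\<not> ?thesis"
  then have nh: "(f ^^ i) u \<noteq> c0" if "u \<in> seg z b" for i u using that by blast
  have bT: "b \<in> T" using V_T assms by auto
  obtain i where i: "periodic_point f ((f ^^ i) b)" using V_preperiodic[OF assms(1)] .
  have "free i z b" unfolding free_def using nh by auto
  note inj = free_inj[OF z_facts(1) bT this]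
  have "(f ^^ i) z = (f ^^ i) b"
  proof (rule never_hit_imp_eq)
    fix j v assume "v \<in> seg ((f ^^ i) z) ((f ^^ i) b)"
    then obtain u where "u \<in> seg z b" "v = (f ^^ i) u" using inj(2) by (metis imageE)
    then show "(f ^^ j) v \<noteq> c0" using nh[of u "j + i"] by (simp add: funpow_add)
  qed (use i periodic_funpow[OF z_per] funpow_T z_facts bT in auto)
  then show False using inj_onD[OF inj(1)] seg_ends[OF z_facts(1) bT] assms(2) by blast
qed

text \<open>Splitting \<open>k\<close> by division by \<open>m\<close> reduces every time to one
  below \<open>m\<close>, counted from a point still in \<open>S\<close>.\<close>

lemma invariant_never_hit:
  assumes "\<And>u. u \<in> S \<Longrightarrow> g u \<in> S" "\<And>u. u \<in> S \<Longrightarrow> \<not> hit u" "u \<in> S"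
  shows "(f ^^ k) u \<noteq> c0"
proof -
  have S: "(g ^^ j) u \<in> S" for j using assms(1,3) by (induction j) auto
  have "f ^^ k = f ^^ (k mod m + m * (k div m))" by simp
  also have "\<dots> = f ^^ (k mod m) \<circ> g ^^ (k div m)" by (simp only: funpow_add funpow_mult)
  finally have "(f ^^ k) u = (f ^^ (k mod m)) ((g ^^ (k div m)) u)" by simp
  moreover have "k mod m < m" using m_pos by simp
  ultimately show ?thesis using assms(2)[OF S[of "k div m"]] unfolding hit_def by metis
qed

text \<open>Otherwise the points \<open>g\<^sup>i b\<close> of the finite set \<open>V\<close> would move away from \<open>z\<close> strictly monotonically.\<close>

lemma no_escape:
  assumes b: "b \<in> V" "b \<in> seg z (g b)" "g b \<noteq> b"
    and mono: "\<And>u v. \<lbrakk>u \<in> T; v \<in> T; b \<in> seg z u; u \<in> seg z v; g b \<in> seg z v; g b \<in> seg z (g u)\<rbrakk>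
      \<Longrightarrow> g u \<in> seg z (g v) \<and> (u \<noteq> v \<longrightarrow> g u \<noteq> g v)"
  shows False
proof -
  let ?G = "\<lambda>i. (g ^^ i) b"
  have GV: "?G i \<in> V" for i by (induction i) (use b V_funpow in auto)
  then have GT: "?G i \<in> T" for i using V_T by auto
  have P: "?G i \<in> seg z (?G (Suc i)) \<and> ?G i \<noteq> ?G (Suc i) \<and> g b \<in> seg z (?G (Suc i)) \<and> b \<in> seg z (?G i)" for i
  proof (induction i)
    case 0
    then show ?case using b seg_ends[OF z_facts(1)] V_T[OF b(1)] V_T[OF V_funpow[OF b(1)]] by auto
  next
    case (Suc i)
    have "g (?G i) \<in> seg z (g (?G (Suc i))) \<and> g (?G i) \<noteq> g (?G (Suc i))"
      using mono[of "?G i" "?G (Suc i)"] GT[of i] GT[of "Suc i"] Suc by simp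
    then have 1: "?G (Suc i) \<in> seg z (?G (Suc (Suc i)))" "?G (Suc i) \<noteq> ?G (Suc (Suc i))" by auto
    moreover have "g b \<in> seg z (?G (Suc (Suc i)))"
      using seg_trans[OF z_facts(1) GT _ 1(1)] Suc by blast
    moreover have "b \<in> seg z (?G (Suc i))" using seg_trans[OF z_facts(1) GT] Suc by blast
    ultimately show ?case by blast
  qed
  have less: "?G i \<in> seg z (?G k) \<and> ?G i \<noteq> ?G k" if "i < k" for i k
    using that
  proof (induction k)
    case (Suc k)
    show ?case
    proof (cases "i = k")
      case True then show ?thesis using P[of i] by auto
    next
      case False
      then have IH: "?G i \<in> seg z (?G k)" "?G i \<noteq> ?G k" using Suc by auto
      have "?G i \<noteq> ?G (Suc k)"
        using seg_antisym[OF z_facts(1) GT GT, of i k] IH P[of k] by metis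
      then show ?thesis using seg_trans[OF z_facts(1) GT IH(1)] P[of k] by blast
    qed
  qed simp
  then have "inj ?G" by (intro linorder_injI) blast
  moreover have "finite (range ?G)" using GV V_finite finite_subset by (metis image_subsetI)
  ultimately show False using finite_imageD by blast
qed

text \<open>If not, \<open>g\<close> is injective on \<open>seg z c1\<close>, and \<open>b\<close>
  is where \<open>seg z (g c1)\<close> leaves this arc. Either \<open>g\<close> maps
  \<open>seg z b\<close> into itself, which \<open>V_hit\<close> excludes, or \<open>g b\<close>
  lies beyond \<open>b\<close> on the side branch and \<open>no_escape\<close> applies.\<close>

lemma hit_exists: "\<exists>u\<in>seg z c1. hit u"
proof (rule ccontr)
  assume "\<not> ?thesis"
  then have nh: "\<not> hit u" if "u \<in> seg z c1" for u using that by auto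
  then have fr: "free m z c1" by (intro free_if_no_hit)
  note inj = free_inj[OF z_facts(1) c1_T fr, unfolded g_z]
  have gC: "g c1 \<in> C" using return_C[OF c1_C fr] .
  then have gT: "g c1 \<in> T" using C_T by auto
  obtain b where b: "b \<in> seg z c1" "b \<in> seg c1 (g c1)" "b \<in> seg z (g c1)"
    using median_exists[OF z_facts(1) c1_T gT] by blast
  then have med: "is_median b z c1 (g c1)" by (simp add: is_median_def)
  have "c1 \<in> orb f c0" "g c1 \<in> orb f c0" using orb_step[OF orb_refl] orb_funpow by metis+
  then have bV: "b \<in> V" unfolding V_def using med orb_refl[of z f] by blast
  have bT: "b \<in> T" using V_T bV by auto
  have bz: "b \<noteq> z" using b(2) gC seg_sym[OF gT c1_T] by (auto simp: C_def)
  have gb: "g b \<in> seg z (g c1)" using inj(2) b(1) by blast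
  have gbT: "g b \<in> T" using funpow_T bT by auto
  have sub: "seg z b \<subseteq> seg z c1" using seg_mono(1)[OF z_facts(1) c1_T b(1)] .
  show False
  proof (cases "g b \<in> seg z b")
    case True
    have "g ` seg z b = seg z (g b)"
      using free_inj(2)[OF z_facts(1) bT free_sub[OF z_facts(1) c1_T fr b(1)]] g_z by simp
    then have "g u \<in> seg z b" if "u \<in> seg z b" for u
      using that seg_mono(1)[OF z_facts(1) bT True] by blast
    then have "(f ^^ k) u \<noteq> c0" if "u \<in> seg z b" for u k
      using invariant_never_hit[of "seg z b"] nh sub that by blast
    then show False using V_hit[OF bV bz] by metis
  next
    case False
    then have bgb: "b \<in> seg z (g b)" using seg_linear[OF z_facts(1) gT b(3) gb] by auto
    have gb_ne: "g b \<noteq> b" using False seg_ends[OF z_facts(1) bT] by auto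
    have off: "g b \<notin> seg z c1"
      using is_median_initial[OF z_facts(1) c1_T gT med _ gb] False by auto
    show False
    proof (rule no_escape[OF bV bgb gb_ne])
      fix u v assume uv: "u \<in> T" "v \<in> T" "b \<in> seg z u" "u \<in> seg z v"
      have bv: "b \<in> seg z v" using seg_trans[OF z_facts(1) uv(2,3,4)] .
      have vC: "v \<in> C" using C_beyond[OF C_seg[OF c1_C b(1) bz] bv uv(2)] .
      \<comment> \<open>The first hit \<open>x\<close> on the way to \<open>v\<close> would lie
        beyond \<open>b\<close>, since \<open>seg z c1\<close> has none. But \<open>g\<close> maps
        \<open>seg z x\<close> onto \<open>seg z c1\<close>, which would then contain
        \<open>g b\<close>, against \<open>off\<close>.\<close>
      have "\<not> hit p" if p: "p \<in> seg z v" for p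
      proof
        assume "hit p"
        then obtain x where x: "x \<in> seg z v" "x \<noteq> z" "x \<in> C" "(f ^^ (m - 1)) x = c0" "free m z x"
          using first_hit_at_end[OF vC p] by metis
        have hx: "hit x" unfolding hit_def using x(4) m_pos by (intro exI[of _ "m - 1"]) auto
        have xT: "x \<in> T" using C_T x by auto
        have "g x = f ((f ^^ (m - 1)) x)" using m_pos by (cases m) auto
        then have gx: "g ` seg z x = seg z c1" using free_inj(2)[OF z_facts(1) xT x(5)] g_z x(4) by simp
        have "x \<notin> seg z b" using nh hx sub by auto
        then have "b \<in> seg z x" using seg_linear[OF z_facts(1) uv(2) bv x(1)] by auto
        then show False using gx off by blast
      qed
      then have "free m z v" by (intro free_if_no_hit)
      note i = free_inj[OF z_facts(1) uv(2) this, unfolded g_z]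
      show "g u \<in> seg z (g v) \<and> (u \<noteq> v \<longrightarrow> g u \<noteq> g v)"
        using i uv(4) seg_ends[OF z_facts(1) uv(2)] inj_onD[OF i(1), of u v] by blast
    qed
  qed
qed

end

section \<open>The closest characteristic point\<close>

lemma snth_cycle:
  assumes "l \<noteq> []"
  shows "cycle l !! i = l ! (i mod length l)"
proof (induction i rule: less_induct)
  case (less i)
  show ?case
  proof (cases "i < length l")
    case True
    then show ?thesis using assms by (subst cycle_decomp) simp_all
  next
    case False
    then have "cycle l !! i = cycle l !! (i - length l)"
      using assms by (subst cycle_decomp) simp_all
    also have "\<dots> = l ! ((i - length l) mod length l)"
    proof (rule less.IH)
      have "0 < length l" using assms by simp
      then show "i - length l < i" using False by arith
    qed
    finally show ?thesis using False by (simp add: le_mod_geq)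
  qed
qed

lemma concat_replicate_stake:
  assumes "sdrop k s = s"
  shows "concat (replicate j (stake k s)) = stake (j * k) s"
proof (induction j)
  case (Suc j)
  have "stake k s @ stake (j * k) s = stake (k + j * k) s"
    using stake_add[of k s "j * k"] assms by simp
  then show ?case using Suc by simp
qed simp

text \<open>As \<open>s\<close> repeats its period word, the repeated word is an initial piece of
  \<open>s\<close>; only its last entry, at index \<open>q * seq_period s - 1\<close>, is
  flipped.\<close>

lemma B_seq_eq:
  assumes "seq_period s > 0" "sdrop (seq_period s) s = s" "q > 0"
  shows "B_seq q s = cycle (stake (q * seq_period s - 1) s @ [flip (s !! (q * seq_period s - 1))])"
proof -
  let ?k = "seq_period s" and ?w = "stake (seq_period s) s"
  obtain k where k: "?k = Suc k" using assms(1) gr0_implies_Suc by blast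
  obtain p where p: "q = Suc p" using assms(3) gr0_implies_Suc by blast
  have "concat (replicate p ?w) @ ?w = concat (replicate p ?w @ [?w])" by simp
  also have "\<dots> = concat (replicate (Suc p) ?w)" by (simp only: replicate_append_same replicate_Suc)
  also have "\<dots> = stake (Suc p * ?k) s" by (rule concat_replicate_stake[OF assms(2)])
  also have "Suc p * ?k = Suc (p * ?k + k)" using k by simp
  also have "stake (Suc (p * ?k + k)) s = stake (p * ?k + k) s @ [s !! (p * ?k + k)]" by (rule stake_Suc)
  finally have e: "concat (replicate p ?w) @ ?w = stake (p * ?k + k) s @ [s !! (p * ?k + k)]" .
  have "?w \<noteq> []" using k by simp
  then have "concat (replicate p ?w) @ butlast ?w = stake (p * ?k + k) s" "last ?w = s !! (p * ?k + k)"
    using arg_cong[OF e, of butlast] arg_cong[OF e, of last] by (simp_all add: butlast_append)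
  moreover have "q * ?k - 1 = p * ?k + k" using k p by simp
  ultimately show ?thesis unfolding B_seq_def Let_def using p by (simp flip: append_assoc)
qed

lemma snth_A_inv: "A_inv k s !! i = (if k dvd Suc i then Star else s !! i)"
proof -
  have "(Suc ^^ i) (Suc 0) = Suc i" by (induction i) auto
  then show ?thesis by (simp add: A_inv_def smap2_szip)
qed

context characteristic_setup
begin

text \<open>A shifted itinerary is that of an iterate of \<open>z\<close>, and minimality tells
  periodic points apart by itineraries. Hence \<open>B_seq\<close> works with a word of length
  exactly \<open>n\<close>.\<close>

lemma seq_period_z: "seq_period (itinerary T f c0 z) = n" "sdrop n (itinerary T f c0 z) = itinerary T f c0 z"
proof -
  let ?s = "itinerary T f c0 z"
  have shift: "sdrop k ?s = itinerary T f c0 ((f ^^ k) z)" for k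
    by (rule stream_eqI) (simp add: sdrop_snth snth_itinerary funpow_add add.commute[of k])
  have iff: "sdrop k ?s = ?s \<longleftrightarrow> (f ^^ k) z = z" for k
  proof
    assume "sdrop k ?s = ?s"
    then have "itinerary T f c0 ((f ^^ k) z) = itinerary T f c0 z" using shift by simp
    moreover have "periodic_point f ((f ^^ k) z)" "(f ^^ k) z \<in> T"
      using periodic_funpow[OF z_per] funpow_T[OF z_facts(1)] by auto
    ultimately show "(f ^^ k) z = z"
      using min_hubbard z_per z_facts(1) unfolding minimal_hubbard_tree_def by blast
  qed (simp add: shift)
  show "seq_period ?s = n" by (simp add: seq_period_def iff n_def period_def)
  show "sdrop n ?s = ?s" using iff period_z by simp
qed

lemma z_between: assumes "q \<in> seg z c1" shows "z \<in> seg c0 q"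
proof -
  have qT: "q \<in> T" using assms seg_in_T z_facts c1_T by blast
  have "z \<in> seg q c0"
    using seg_between[OF c1_T c0_T, of z q] assms z_facts seg_sym c1_T c0_T by auto
  then show ?thesis using seg_sym qT c0_T by auto
qed

lemma seg_beyond:
  assumes "p \<in> T" "q \<in> T" "a \<in> T" "a \<in> seg p q" "b \<in> seg a q"
  shows "a \<in> seg p b"
proof -
  have bT: "b \<in> T" using assms seg_in_T by blast
  have "a \<in> seg b p" using seg_between[OF assms(2,1), of a b] assms seg_sym bT by auto
  then show ?thesis using seg_sym bT assms by auto
qed

lemma g_funpow_mod: assumes "g p = p" shows "(f ^^ i) p = (f ^^ (i mod m)) p"
  using funpow_mod_eq[OF assms, of i] by simp

lemma never_hit_return:
  assumes "w \<in> T" "periodic_point f w" "w \<noteq> z" "g w \<in> seg z w" "\<And>u. u \<in> seg z w \<Longrightarrow> \<not> hit u"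
  shows False
proof -
  have "free m z w" using assms(5) by (intro free_if_no_hit)
  then have "g ` seg z w = seg z (g w)" using free_inj(2)[OF z_facts(1) assms(1)] g_z by simp
  then have "g u \<in> seg z w" if "u \<in> seg z w" for u
    using that seg_mono(1)[OF z_facts(1) assms(1,4)] by blast
  then have "(f ^^ k) u \<noteq> c0" if "u \<in> seg z w" for u k
    using invariant_never_hit[of "seg z w"] assms(5) that by blast
  then show False
    using never_hit_imp_eq[OF z_facts(1) assms(1) z_per assms(2)] assms(3) by blast
qed

end

section \<open>The return map beyond the first precritical point \<open>x\<close>\<close>

locale first_precritical = characteristic_setup +
  fixes x :: 'a
  assumes x_seg: "x \<in> seg z c1" and x_z: "x \<noteq> z" and x_crit: "(f ^^ (m - 1)) x = c0"
    and x_free: "free m z x" and x_early: "i < m - 1 \<Longrightarrow> (f ^^ i) x \<noteq> c0"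
begin

lemma x_C: "x \<in> C" using C_seg[OF c1_C x_seg x_z] .

lemma x_T: "x \<in> T" using x_C C_T by auto

lemma g_x: "g x = c1"
proof -
  have "g x = f ((f ^^ (m - 1)) x)" using m_pos by (cases m) auto
  then show ?thesis using x_crit by simp
qed

lemma inj_x: "inj_on g (seg z x)" "g ` seg z x = seg z c1"
  using free_inj[OF z_facts(1) x_T x_free] g_z g_x by auto

lemma no_hit_before: assumes "u \<in> seg z x" "u \<noteq> x" shows "\<not> hit u"
  using x_free assms z_not_hit unfolding free_def hit_def by metis

text \<open>Here \<open>g\<close> maps \<open>seg z c1\<close> homeomorphically onto itself and
  fixes \<open>c1\<close>, the only point of the arc with a hit. A characteristic point in between
  would have the itinerary of \<open>z\<close>.\<close>

lemma closest_is_critical_value: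
  assumes "x = c1"
  shows "w \<in> open_arc T z c1 \<Longrightarrow> \<not> characteristic_point T f c0 w"
    "kneading_sequence T f c0 = A_inv m (itinerary T f c0 z)"
proof -
  show "\<not> characteristic_point T f c0 w" if w: "w \<in> open_arc T z c1"
  proof
    assume "characteristic_point T f c0 w"
    moreover have w': "w \<in> seg z c1" "w \<noteq> z" "w \<noteq> c1" "w \<in> T"
      using w seg_in_T z_facts c1_T by (auto simp: open_arc_def)
    ultimately have per: "periodic_point f w" using characteristic_iff by auto
    let ?S = "seg z c1 - {c1}"
    have "g u \<in> ?S" if u: "u \<in> ?S" for u
    proof -
      have "g u \<in> seg z c1" using inj_x(2) u assms by blast
      moreover have "g u \<noteq> c1"
        using inj_onD[OF inj_x(1), of u x] u assms g_x seg_ends[OF z_facts(1) c1_T] by auto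
      ultimately show ?thesis by auto
    qed
    moreover have "\<not> hit u" if "u \<in> ?S" for u using no_hit_before assms that by auto
    ultimately have nh: "(f ^^ k) u \<noteq> c0" if "u \<in> ?S" for u k
      using invariant_never_hit[of ?S] that by blast
    have "seg z w \<subseteq> ?S"
      using seg_mono(1)[OF z_facts(1) c1_T w'(1)] seg_antisym[OF z_facts(1) c1_T w'(4)] w' by auto
    then show False using never_hit_imp_eq[OF z_facts(1) w'(4) z_per per] nh w'(2) by blast
  qed
  show "kneading_sequence T f c0 = A_inv m (itinerary T f c0 z)"
  proof (rule stream_eqI)
    fix i
    define r where "r = i mod m"
    have r: "r < m" using m_pos by (simp add: r_def)
    have fi: "(f ^^ i) c1 = (f ^^ r) c1" "(f ^^ i) z = (f ^^ r) z"
      using g_funpow_mod[of c1 i] g_funpow_mod[of z i] g_x assms g_z by (simp_all only: r_def)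
    \<comment> \<open>Indices start at 0 but \<open>A_inv\<close> counts from 1, so stars stand
      exactly at the indices congruent to \<open>m - 1\<close>, when \<open>c1\<close> arrives at
      \<open>c0\<close>.\<close>
    have "Suc i mod m = (if Suc r = m then 0 else Suc r)" by (simp add: r_def mod_Suc)
    then have dvd: "m dvd Suc i \<longleftrightarrow> r = m - 1" using r by (auto simp: dvd_eq_mod_eq_0)
    show "kneading_sequence T f c0 !! i = A_inv m (itinerary T f c0 z) !! i"
    proof (cases "r = m - 1")
      case True
      then have "(f ^^ i) c1 = c0" using x_crit assms fi by simp
      then show ?thesis using dvd True
        by (simp add: kneading_sequence_def snth_itinerary snth_A_inv position_def)
    next
      case False
      have "(f ^^ r) u \<noteq> c0" if "u \<in> seg z c1" for u
        using no_hit_before[of u] x_early[of r] that assms r False unfolding hit_def by (cases "u = x") auto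
      from position_funpow_eq[OF z_facts(1) c1_T this] show ?thesis using dvd False fi
        by (simp add: kneading_sequence_def snth_itinerary snth_A_inv)
    qed
  qed
qed

text \<open>The next point \<open>v\<close> with a hit beyond \<open>x\<close> does not hit at time
  \<open>m - 1\<close>, since \<open>x\<close> does and \<open>f ^^ (m - 1)\<close> is injective on
  \<open>seg z v\<close>. So it hits earlier, and \<open>early_hit\<close> yields a point
  \<open>y\<close> before \<open>v\<close> that visits \<open>z\<close>. It lies beyond
  \<open>x\<close> because \<open>seg z x\<close> is free up to time \<open>m\<close>.\<close>

lemma second_hit:
  assumes "w \<in> T" "x \<in> seg z w" "u0 \<in> seg x w" "u0 \<noteq> x" "hit u0"
  obtains y where "y \<in> seg x w" "y \<noteq> x" "\<forall>u\<in>seg x y. u \<noteq> x \<longrightarrow> \<not> hit u" "g y \<in> orb f z"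
proof -
  let ?H = "{u\<in>T. \<exists>i<m. (f ^^ i) u = c0} - {x}"
  have H: "u \<in> ?H \<longleftrightarrow> u \<in> T \<and> hit u \<and> u \<noteq> x" for u by (auto simp: hit_def)
  have ne: "?H \<inter> seg x w \<noteq> {}" using assms H seg_in_T[OF _ x_T assms(1)] by blast
  obtain v where v: "v \<in> ?H" "v \<in> seg x w" "\<forall>u\<in>?H. u \<in> seg x v \<longrightarrow> u = v"
    using first_hit[OF x_T assms(1) finite_Diff[OF finite_hits] ne] .
  have vT: "v \<in> T" and vx: "v \<noteq> x" using v by auto
  have xv: "x \<in> seg z v" using seg_beyond[OF z_facts(1) assms(1) x_T assms(2) v(2)] .
  have vC: "v \<in> C" using C_beyond[OF x_C xv vT] .
  have before: "\<not> hit u" if "u \<in> seg x v" "u \<noteq> x" "u \<noteq> v" for u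
    using that v(3) H seg_in_T[OF _ x_T vT] by blast
  then have frxv: "free m x v" by (intro free_if_no_hit)
  \<comment> \<open>At time \<open>m - 1\<close> the interior point \<open>x\<close> is at
    \<open>c0\<close>, where \<open>f\<close> may fold the arc; hence the bound on
    \<open>k\<close>.\<close>
  have fr: "free k z v" if "k \<le> m - 1" for k
    using free_join[OF z_facts(1) vT xv] free_mono[OF x_free] free_mono[OF frxv] x_early that by simp
  obtain i where i: "i < m" "(f ^^ i) v = c0" using v(1) by auto
  have "i \<noteq> m - 1"
    using inj_onD[OF free_inj(1)[OF z_facts(1) vT fr[of "m - 1"]], of x v] x_crit i vx xv
      seg_ends[OF z_facts(1) vT] by auto
  then have im: "Suc i < m" using i by auto
  then have fr_i: "free (Suc i) z v" using fr by simp
  obtain y where y: "y \<in> seg z v" "y \<noteq> z" "y \<noteq> v" "(f ^^ Suc i) y = z"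
    using early_hit[OF vC im fr_i i(2)] by metis
  have yT: "y \<in> T" using y seg_in_T z_facts vT by blast
  have "y \<notin> seg z x"
    using free_avoids_z[OF C_seg[OF x_C _ y(2)] free_sub[OF z_facts(1) x_T x_free], of "Suc i"] y(4) im by auto
  then have yx: "y \<in> seg x v" "y \<noteq> x"
    using seg_split(1)[OF z_facts(1) vT xv] y(1) seg_ends[OF z_facts(1) x_T] by auto
  have "\<not> hit u" if u: "u \<in> seg x y" "u \<noteq> x" for u
  proof (rule before[OF _ u(2)])
    show "u \<in> seg x v" using seg_trans[OF x_T vT u(1) yx(1)] .
    show "u \<noteq> v" using seg_antisym[OF x_T vT yT] u(1) yx(1) y(3) by auto
  qed
  moreover have "y \<in> seg x w" using seg_trans[OF x_T assms(1) yx(1) v(2)] .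
  ultimately show ?thesis using that yx(2) orb_z_after[OF y(4)] im by auto
qed

lemma inj_beyond:
  assumes "y \<in> T" "\<forall>u\<in>seg x y. u \<noteq> x \<longrightarrow> \<not> hit u"
  shows "inj_on g (seg x y)" "g ` seg x y = seg c1 (g y)"
proof -
  have "free m x y" by (rule free_if_no_hit) (use assms(2) in blast)
  from free_inj[OF x_T assms(1) this] show "inj_on g (seg x y)" "g ` seg x y = seg c1 (g y)"
    using g_x by auto
qed

text \<open>\<open>g\<close> carries \<open>x\<close> to the far end \<open>c1\<close> and
  \<open>y\<close> back into \<open>seg x y\<close>, the situation of
  \<open>seg_fixed_point\<close>. The fixed point is not \<open>c1\<close>, which by injectivity is
  the image of \<open>x\<close> alone.\<close>

lemma fixed_point_if_returns:
  assumes "x \<noteq> c1" "y \<in> seg x c1" "\<forall>u\<in>seg x y. u \<noteq> x \<longrightarrow> \<not> hit u" "g y \<in> seg x y"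
  shows "\<exists>p\<in>seg x c1. p \<noteq> x \<and> p \<noteq> c1 \<and> g p = p \<and> (\<forall>u\<in>seg x p. u \<noteq> x \<longrightarrow> \<not> hit u)"
proof -
  have yT: "y \<in> T" using assms seg_in_T x_T c1_T by blast
  have gy: "g y \<in> seg x c1" using seg_trans[OF x_T c1_T assms(4,2)] .
  have gyT: "g y \<in> T" using funpow_T yT by auto
  note i = inj_beyond[OF yT assms(3)]
  have "g ` seg x y \<subseteq> seg x c1"
    using i(2) seg_mono(2)[OF x_T c1_T gy] seg_sym[OF c1_T gyT] by auto
  moreover have "continuous_on (seg x y) g"
    using cont_funpow seg_subset[OF x_T yT] continuous_on_subset by blast
  ultimately obtain p where p: "p \<in> seg x y" "g p = p"
    using seg_fixed_point[OF x_T c1_T assms(2), of g] g_x assms(4) by blast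
  have "p \<noteq> x" using p g_x assms(1) by auto
  moreover have "p \<noteq> c1"
    using inj_onD[OF i(1), of p x] p g_x assms(1) seg_ends[OF x_T yT] by auto
  moreover have "p \<in> seg x c1" using seg_trans[OF x_T c1_T p(1) assms(2)] .
  moreover have "\<forall>u\<in>seg x p. u \<noteq> x \<longrightarrow> \<not> hit u"
    using assms(3) seg_trans[OF x_T yT _ p(1)] by blast
  ultimately show ?thesis using p(2) by blast
qed

lemma fixed_point_if_covers:
  assumes "x \<noteq> c1" "y \<in> seg x c1" "\<forall>u\<in>seg x y. u \<noteq> x \<longrightarrow> \<not> hit u" "x \<in> seg c1 (g y)"
  shows "\<exists>p\<in>seg x c1. p \<noteq> x \<and> p \<noteq> c1 \<and> g p = p \<and> (\<forall>u\<in>seg x p. u \<noteq> x \<longrightarrow> \<not> hit u)"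
proof -
  have yT: "y \<in> T" using assms seg_in_T x_T c1_T by blast
  obtain y' where y': "y' \<in> seg x y" "g y' = x" using inj_beyond(2)[OF yT assms(3)] assms(4) by (metis imageE)
  have y'T: "y' \<in> T" using y' seg_in_T x_T yT by blast
  have "\<forall>u\<in>seg x y'. u \<noteq> x \<longrightarrow> \<not> hit u" using assms(3) seg_trans[OF x_T yT _ y'(1)] by blast
  then show ?thesis
    using fixed_point_if_returns[OF assms(1) seg_trans[OF x_T c1_T y'(1) assms(2)]] y'(2)
      seg_ends[OF x_T y'T] by auto
qed

text \<open>A further hit beyond \<open>x\<close> provides a point whose image is separated from
  \<open>c1\<close> by \<open>z\<close>, so the image arc covers \<open>x\<close>. Without one,
  \<open>g\<close> is injective on \<open>seg x c1\<close>, and the branching point \<open>b\<close>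
  of \<open>c1\<close>, \<open>z\<close>, \<open>g c1\<close> decides: the image covers
  \<open>x\<close>, or a point returns, or \<open>b\<close> escapes.\<close>

lemma fixed_point_exists:
  assumes "x \<noteq> c1"
  shows "\<exists>p\<in>seg x c1. p \<noteq> x \<and> p \<noteq> c1 \<and> g p = p \<and> (\<forall>u\<in>seg x p. u \<noteq> x \<longrightarrow> \<not> hit u)"
proof (cases "\<exists>u\<in>seg x c1. u \<noteq> x \<and> hit u")
  case True
  then obtain y where y: "y \<in> seg x c1" "\<forall>u\<in>seg x y. u \<noteq> x \<longrightarrow> \<not> hit u" "g y \<in> orb f z"
    using second_hit[OF c1_T x_seg] by metis
  have gyT: "g y \<in> T" using funpow_T seg_in_T[OF y(1) x_T c1_T] by auto
  have "x \<in> seg (g y) c1"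
    using seg_mono(2)[OF gyT c1_T orb_z_sep[OF y(3)]] x_seg by auto
  then show ?thesis using fixed_point_if_covers[OF assms y(1,2)] seg_sym gyT c1_T by auto
next
  case False
  then have nh: "\<forall>u\<in>seg x c1. u \<noteq> x \<longrightarrow> \<not> hit u" by blast
  note inj = inj_beyond[OF c1_T nh]
  have gT: "g c1 \<in> T" using funpow_T c1_T by auto
  obtain b where b: "b \<in> seg c1 z" "b \<in> seg z (g c1)" "b \<in> seg c1 (g c1)"
    using median_exists[OF c1_T z_facts(1) gT] by blast
  then have med: "is_median b c1 z (g c1)" by (simp add: is_median_def)
  have bz: "b \<in> seg z c1" using b seg_sym z_facts c1_T by auto
  have bT: "b \<in> T" using bz seg_in_T z_facts c1_T by blast
  show ?thesis
  proof (cases "b \<in> seg z x")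
    case True
    have "x \<in> seg b c1" using seg_between[OF z_facts(1) c1_T x_seg True] .
    then have "x \<in> seg c1 (g c1)"
      using seg_sym[OF bT c1_T] seg_mono(1)[OF c1_T gT b(3)] by auto
    then show ?thesis using fixed_point_if_covers[OF assms _ nh] seg_ends[OF x_T c1_T] by auto
  next
    case False
    then have xb: "x \<in> seg z b" using seg_linear[OF z_facts(1) c1_T x_seg bz] by auto
    have bx: "b \<in> seg x c1" using seg_between[OF z_facts(1) c1_T bz xb] .
    \<comment> \<open>\<open>b\<close> lies on the image arc \<open>seg c1 (g c1)\<close>. The order
      of its preimage \<open>b'\<close> and \<open>b\<close> tells whether \<open>b'\<close> is
      brought back or \<open>b\<close> is pushed onto the side branch.\<close>
    obtain b' where b': "b' \<in> seg x c1" "g b' = b" using inj(2) b(3) by (metis imageE)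
    have b'T: "b' \<in> T" using b' seg_in_T x_T c1_T by blast
    have nh': "\<forall>u\<in>seg x p. u \<noteq> x \<longrightarrow> \<not> hit u" if "p \<in> seg x c1" for p
      using nh seg_trans[OF x_T c1_T _ that] by blast
    show ?thesis
    proof (cases "b \<in> seg x b'")
      case True
      then show ?thesis using fixed_point_if_returns[OF assms b'(1) nh'[OF b'(1)]] b'(2) by auto
    next
      case not_b: False
      then have b'b: "b' \<in> seg x b" using seg_linear[OF x_T c1_T b'(1) bx] by auto
      have "b' \<noteq> b" using not_b seg_ends[OF x_T b'T] by auto
      then have gb_ne: "g b \<noteq> b" using inj_onD[OF inj(1) _ bx b'(1)] b'(2) by auto
      have gbT: "g b \<in> T" using funpow_T bT by auto
      have b_gb: "b \<in> seg c1 (g b)"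
        using inj_beyond(2)[OF bT nh'[OF bx]] b'b b'(2) by (metis imageI)
      have gb: "g b \<in> seg c1 (g c1)" using inj(2) bx by blast
      have off: "g b \<notin> seg c1 z"
        using is_median_initial[OF c1_T z_facts(1) gT med _ gb] seg_antisym[OF c1_T bT gbT b_gb] gb_ne by auto
      have "g b \<in> seg b (g c1)" using seg_between[OF c1_T gT gb b_gb] .
      then have bgb: "b \<in> seg z (g b)" using seg_beyond[OF z_facts(1) gT bT b(2)] by auto
      have z_off: "z \<notin> seg c1 (g c1)"
      proof
        assume "z \<in> seg c1 (g c1)"
        then have "z \<in> seg c1 b"
          using is_median_initial[OF c1_T z_facts(1) gT med] seg_ends[OF c1_T z_facts(1)] by auto
        then have "b = z" using seg_antisym[OF c1_T bT z_facts(1) b(1)] by auto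
        then show False using xb x_z by auto
      qed
      have "c1 \<in> orb f c0" "g c1 \<in> orb f c0" using orb_step[OF orb_refl] orb_funpow by metis+
      then have bV: "b \<in> V" unfolding V_def using med orb_refl[of z f] by blast
      have False
      proof (rule no_escape[OF bV bgb gb_ne])
        fix u v assume uv: "u \<in> T" "v \<in> T" "b \<in> seg z u" "u \<in> seg z v" "g b \<in> seg z v" "g b \<in> seg z (g u)"
        have bv: "b \<in> seg z v" using seg_trans[OF z_facts(1) uv(2,3,4)] .
        have xv: "x \<in> seg z v" using seg_trans[OF z_facts(1) uv(2) xb bv] .
        have xu: "x \<in> seg z u" using seg_trans[OF z_facts(1) uv(1) xb uv(3)] .
        have bxv: "b \<in> seg x v" using seg_between[OF z_facts(1) uv(2) bv xb] .
        have uxv: "u \<in> seg x v" using seg_between[OF z_facts(1) uv(2,4) xu] .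
        have gvT: "g v \<in> T" using funpow_T uv by auto
        \<comment> \<open>A hit would give \<open>y\<close> beyond \<open>x\<close> with
          \<open>g y\<close> separated from \<open>c1\<close> by \<open>z\<close>. If
          \<open>y\<close> comes before \<open>b\<close>, then \<open>z\<close> is on
          \<open>seg c1 (g c1)\<close>; if after, \<open>g b\<close> is on the way from
          \<open>c1\<close> to \<open>g y\<close> but off \<open>seg c1 z\<close>, hence past
          \<open>z\<close>. Both contradict \<open>z_off\<close>.\<close>
        have nhv: "\<not> hit u0" if u0: "u0 \<in> seg x v" "u0 \<noteq> x" for u0
        proof
          assume "hit u0"
          then obtain y where y: "y \<in> seg x v" "\<forall>u\<in>seg x y. u \<noteq> x \<longrightarrow> \<not> hit u" "g y \<in> orb f z"
            using second_hit[OF uv(2) xv u0] by metis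
          have yT: "y \<in> T" using y seg_in_T x_T uv by blast
          have gyT: "g y \<in> T" using funpow_T yT by auto
          have zs: "z \<in> seg (g y) c1" using orb_z_sep[OF y(3)] .
          consider "y \<in> seg x b" | "b \<in> seg x y" using seg_linear[OF x_T uv(2) bxv y(1)] by auto
          then show False
          proof cases
            case 1
            then have "g y \<in> seg c1 (g c1)" using inj(2) seg_trans[OF x_T c1_T 1 bx] by blast
            then have "seg c1 (g y) \<subseteq> seg c1 (g c1)" using seg_mono(1)[OF c1_T gT] by auto
            then show False using z_off zs seg_sym[OF gyT c1_T] by auto
          next
            case 2
            then have "g b \<in> seg c1 (g y)" using inj_beyond(2)[OF yT y(2)] by blast
            then have "g b \<in> seg z (g y)" using seg_triangle[OF c1_T gyT z_facts(1)] off by auto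
            then have "g b \<in> seg (g y) z" using seg_sym[OF z_facts(1) gyT] by auto
            then have "z \<in> seg (g b) c1" using seg_between[OF gyT c1_T zs] by auto
            then show False using z_off seg_mono(1)[OF c1_T gT gb] seg_sym[OF gbT c1_T] by auto
          qed
        qed
        note iv = inj_beyond[OF uv(2), OF ballI[OF impI[OF nhv]]]
        have "g u \<in> seg c1 (g v)" using iv(2) uxv by blast
        moreover have "g u \<notin> seg c1 z"
          using seg_trans[OF z_facts(1) c1_T uv(6)] off seg_sym[OF z_facts(1) c1_T] by auto
        ultimately have "g u \<in> seg z (g v)" using seg_triangle[OF c1_T gvT z_facts(1)] by auto
        moreover have "u \<noteq> v \<longrightarrow> g u \<noteq> g v"
          using inj_onD[OF iv(1) _ uxv] seg_ends[OF x_T uv(2)] by blast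
        ultimately show "g u \<in> seg z (g v) \<and> (u \<noteq> v \<longrightarrow> g u \<noteq> g v)" by blast
      qed
      then show ?thesis ..
    qed
  qed
qed

text \<open>On \<open>seg z p\<close> only \<open>x\<close> has a hit, and only at time
  \<open>m - 1\<close>. So the symbols of \<open>z\<close> and \<open>p\<close> agree at all earlier
  times and are opposite at \<open>m - 1\<close>, and iterates up to that time are injective on the
  arc.\<close>

lemma fixed_point_is_closest:
  assumes p: "p \<in> seg x c1" "p \<noteq> x" "p \<noteq> c1" "g p = p" and nh: "\<forall>u\<in>seg x p. u \<noteq> x \<longrightarrow> \<not> hit u"
  shows "p \<in> open_arc T z c1" "characteristic_point T f c0 p"
    "w \<in> open_arc T z p \<Longrightarrow> \<not> characteristic_point T f c0 w"
    "itinerary T f c0 p = B_seq Q (itinerary T f c0 z)"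
proof -
  have pT: "p \<in> T" using p seg_in_T x_T c1_T by blast
  have xp: "x \<in> seg z p" using seg_beyond[OF z_facts(1) c1_T x_T x_seg p(1)] .
  have pz1: "p \<in> seg z c1" using seg_mono(2)[OF z_facts(1) c1_T x_seg] p by auto
  have pC: "p \<in> C" using C_beyond[OF x_C xp pT] .
  have pz: "p \<noteq> z" using C_ne pC by auto
  show open_p: "p \<in> open_arc T z c1" using pz1 pz p by (auto simp: open_arc_def)
  note inj = inj_beyond[OF pT nh, unfolded p(4)]
  have z_off: "z \<notin> seg c1 p" using pC seg_sym[OF pT c1_T] by (auto simp: C_def)
  have split: "u \<in> seg z x \<or> u \<in> seg x p \<and> u \<noteq> x" if "u \<in> seg z p" for u
    using seg_split(1)[OF z_facts(1) pT xp] that seg_ends[OF z_facts(1) x_T] by auto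
  have early: "(f ^^ i) u \<noteq> c0" if "i < m - 1" "u \<in> seg z p" for i u
  proof -
    have "i < m" using that by auto
    then show ?thesis
      using split[OF that(2)] no_hit_before[of u] x_early[OF that(1)] nh unfolding hit_def
      by (cases "u = x") auto
  qed
  then have fr: "free r z p" if "r \<le> m - 1" for r using that unfolding free_def by auto
  have "\<not> hit p" using nh p seg_ends[OF x_T pT] by auto
  then have never: "(f ^^ i) p \<noteq> c0" for i using invariant_never_hit[of "{p}"] p(4) by auto
  have per: "periodic_point f p" unfolding periodic_point_def using p(4) m_pos by auto
  have disj: "orb f p \<inter> orb f c0 = {}"
  proof (rule ccontr)
    assume "orb f p \<inter> orb f c0 \<noteq> {}"
    then obtain i y where y: "y = (f ^^ i) p" "y \<in> orb f c0" by (auto simp: orb_def)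
    obtain k where "(f ^^ k) y = c0" using orb_periodic_back[OF periodic_c0 y(2)] by metis
    then have "(f ^^ (k + i)) p = c0" using y by (simp add: funpow_add)
    then show False using never by auto
  qed
  have z_before: "z \<in> seg c0 p" using z_between[OF pz1] .
  \<comment> \<open>An iterate of \<open>p\<close> at or beyond \<open>p\<close> at a time
    \<open>r\<close> with \<open>0 < r < m\<close> would contradict the period of the arm if
    \<open>z\<close> returns at time \<open>r\<close>. Otherwise some point of
    \<open>seg z p\<close> is mapped to \<open>z\<close> at that time, and its image under
    \<open>g\<close> lies on \<open>seg c1 p\<close> although \<open>z\<close> separates it from
    \<open>c1\<close>; but \<open>z \<notin> seg c1 p\<close>.\<close>
  have sep: "(f ^^ i) p = p \<or> p \<notin> seg c0 ((f ^^ i) p)" for i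
  proof (cases "i mod m = 0")
    case True
    then show ?thesis using g_funpow_mod[OF p(4), of i] by simp
  next
    case False
    define r where "r = i mod m"
    have r: "0 < r" "r < m" using False m_pos by (auto simp: r_def)
    have fi: "(f ^^ i) p = (f ^^ r) p" using g_funpow_mod[OF p(4), of i] by (simp only: r_def)
    have fT: "(f ^^ r) p \<in> T" "(f ^^ r) z \<in> T" using funpow_T pT z_facts by auto
    have frr: "free r z p" using fr r by auto
    have "p \<notin> seg c0 ((f ^^ r) p)"
    proof
      assume a: "p \<in> seg c0 ((f ^^ r) p)"
      show False
      proof (cases "(f ^^ r) z = z")
        case True
        have "p \<in> seg z ((f ^^ r) p)" using seg_between[OF c0_T fT(1) a z_before] .
        then have "(f ^^ r) p \<in> C" using C_beyond[OF pC _ fT(1)] by auto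
        then show False using early_return_C[OF pC r True frr] by auto
      next
        case F: False
        have "z \<in> seg c0 ((f ^^ r) p)" using seg_trans[OF c0_T fT(1) z_before a] .
        then have "z \<in> seg ((f ^^ r) z) ((f ^^ r) p)"
          using seg_triangle[OF c0_T fT(1,2)] z_sep[of r] F by auto
        then obtain y where y: "y \<in> seg z p" "(f ^^ r) y = z"
          using free_inj(2)[OF z_facts(1) pT frr] by (metis imageE)
        have yz: "y \<noteq> z" using y F by auto
        have "y \<notin> seg z x"
          using free_avoids_z[OF C_seg[OF x_C _ yz] free_sub[OF z_facts(1) x_T x_free], of r] y(2) r by auto
        then have "g y \<in> seg c1 p" using split[OF y(1)] inj(2) by blast
        then have "seg c1 (g y) \<subseteq> seg c1 p" using seg_mono(1)[OF c1_T pT] by auto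
        moreover have "z \<in> seg (g y) c1" using orb_z_sep orb_z_after[OF y(2)] r by auto
        moreover have "g y \<in> T" using funpow_T seg_in_T[OF y(1) z_facts(1) pT] by auto
        ultimately show False using z_off seg_sym[OF _ c1_T] by auto
      qed
    qed
    then show ?thesis using fi by simp
  qed
  have "seg z c1 \<subseteq> seg c0 c1" using seg_mono(2)[OF c0_T c1_T z_facts(4)] .
  then show "characteristic_point T f c0 p"
    using characteristic_iff[OF pT p(3)] per disj sep pz1 by auto
  show "\<not> characteristic_point T f c0 w" if w: "w \<in> open_arc T z p"
  proof
    assume ch: "characteristic_point T f c0 w"
    have w': "w \<in> seg z p" "w \<noteq> z" "w \<noteq> p" using w by (auto simp: open_arc_def)
    have wT: "w \<in> T" using w' seg_in_T z_facts pT by blast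
    have wz1: "w \<in> seg z c1" using seg_trans[OF z_facts(1) c1_T w'(1) pz1] .
    have w1: "w \<noteq> c1" using seg_antisym[OF z_facts(1) c1_T pT] w'(1) pz1 p(3) by auto
    have perw: "periodic_point f w" and disjw: "orb f w \<inter> orb f c0 = {}"
      and sepw: "g w = w \<or> w \<notin> seg c0 (g w)"
      using characteristic_iff[OF wT w1] ch by auto
    have gwT: "g w \<in> T" using funpow_T wT by auto
    \<comment> \<open>No iterate of a characteristic point lies strictly beyond it as seen from
      \<open>c0\<close>.\<close>
    have ret: "g w = w" if "g w \<in> seg z c1" "w \<in> seg z (g w)"
      using sepw seg_mono(2)[OF c0_T gwT z_between[OF that(1)]] that(2) by auto
    from split[OF w'(1)] show False
    proof
      assume wx: "w \<in> seg z x"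
      have "w \<noteq> x"
      proof
        assume "w = x"
        then have "c0 \<in> orb f w" using x_crit unfolding orb_def by (metis rangeI)
        then show False using disjw orb_refl[of c0 f] by auto
      qed
      have gw: "g w \<in> seg z c1" using inj_x(2) wx by blast
      have "g w \<in> seg z w"
        using seg_linear[OF z_facts(1) c1_T wz1 gw] ret[OF gw] seg_ends[OF z_facts(1) wT] by auto
      moreover have "\<not> hit u" if "u \<in> seg z w" for u
      proof (rule no_hit_before)
        show "u \<in> seg z x" using seg_trans[OF z_facts(1) x_T that wx] .
        show "u \<noteq> x" using seg_antisym[OF z_facts(1) x_T wT] wx that \<open>w \<noteq> x\<close> by auto
      qed
      ultimately show False using never_hit_return[OF wT perw w'(2)] by blast
    next
      \<comment> \<open>Beyond \<open>x\<close> the map \<open>g\<close> reverses the order and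
        fixes \<open>p\<close>, so \<open>g w\<close> lands at or beyond \<open>p\<close>, hence
        strictly beyond \<open>w\<close>.\<close>
      assume wx: "w \<in> seg x p \<and> w \<noteq> x"
      have gw: "g w \<in> seg p c1" using inj(2) wx seg_sym[OF pT c1_T] by blast
      have pgw: "p \<in> seg z (g w)" using seg_beyond[OF z_facts(1) c1_T pT pz1 gw] .
      have "g w \<in> seg z c1" using gw seg_mono(2)[OF z_facts(1) c1_T pz1] by auto
      then have "g w = w" using ret seg_trans[OF z_facts(1) gwT w'(1) pgw] by auto
      then show False using seg_antisym[OF z_facts(1) pT wT] pgw w'(1,3) by auto
    qed
  qed
  show "itinerary T f c0 p = B_seq Q (itinerary T f c0 z)"
  proof -
    let ?s = "itinerary T f c0 z"
    let ?l = "stake (m - 1) ?s @ [flip (?s !! (m - 1))]"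
    have B: "B_seq Q ?s = cycle ?l"
      using B_seq_eq[of ?s Q] seq_period_z period_z(1) Q_facts(1) by (simp add: m_def)
    have len: "length ?l = m" using m_pos by simp
    \<comment> \<open>At this time \<open>c0\<close>, as the image of \<open>x\<close>, lies between
      the images of \<open>z\<close> and \<open>p\<close>.\<close>
    have flip_pos: "position T f c0 ((f ^^ (m - 1)) p) = flip (position T f c0 ((f ^^ (m - 1)) z))"
    proof (rule position_flip)
      have "(f ^^ (m - 1)) x \<in> seg ((f ^^ (m - 1)) z) ((f ^^ (m - 1)) p)"
        using free_inj(2)[OF z_facts(1) pT fr[OF order_refl]] xp by blast
      then show "c0 \<in> seg ((f ^^ (m - 1)) z) ((f ^^ (m - 1)) p)" using x_crit by simp
    qed (use z_facts funpow_T pT never z_not_hit in auto)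
    have pos: "position T f c0 ((f ^^ r) p) = ?l ! r" if "r < m" for r
    proof (cases "r = m - 1")
      case True
      then show ?thesis using flip_pos by (simp add: nth_append snth_itinerary)
    next
      case False
      then have "r < m - 1" using that by auto
      then show ?thesis using position_funpow_eq[OF z_facts(1) pT early]
        by (simp add: nth_append snth_itinerary)
    qed
    show ?thesis
    proof (rule stream_eqI)
      fix i
      have "itinerary T f c0 p !! i = ?l ! (i mod m)"
        using pos[of "i mod m"] m_pos g_funpow_mod[OF p(4), of i] by (simp add: snth_itinerary)
      also have "\<dots> = B_seq Q ?s !! i" using snth_cycle[of ?l i] len B by simp
      finally show "itinerary T f c0 p !! i = B_seq Q ?s !! i" .
    qed
  qed
qed

end

section \<open>Conclusion from the two positions of \<open>x\<close>: at \<open>c1\<close> or before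
  it\<close>

theorem theorem3p11:
  fixes T :: "'a::metric_space set" and f :: "'a \<Rightarrow> 'a" and c0 c1 z :: 'a
    and \<nu> \<tau> :: "symbol stream" and n Q :: nat
  assumes "minimal_hubbard_tree T f c0"
    and "c1 = f c0"
    and "\<nu> = kneading_sequence T f c0"
    and "z \<in> open_arc T c0 c1"
    and "characteristic_point T f c0 z"
    and "n = period f z"
    and "\<tau> = itinerary T f c0 z"
    and "Q = local_arm_period f z (local_arm T z c1)"
  shows "\<exists>z'. z' \<in> left_open_arc T z c1 \<and> characteristic_point T f c0 z' \<and>
           (\<forall>w\<in>open_arc T z z'. \<not> characteristic_point T f c0 w) \<and>
           (z' \<in> open_arc T z c1 \<and> itinerary T f c0 z' = B_seq Q \<tau> \<or>
            z' = c1 \<and> \<nu> = A_inv (Q * n) \<tau>)"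
proof -
  interpret S: characteristic_setup T f c0 z
    by unfold_locales (use assms in auto)
  have Qn: "Q = S.Q" "n = S.n" "Q * n = S.m" using assms by (auto simp: S.Q_def S.n_def S.m_def)
  obtain u where u: "u \<in> S.seg z (f c0)" "S.hit u" using S.hit_exists by blast
  obtain x where x: "x \<in> S.seg z (f c0)" "x \<noteq> z" "(f ^^ (S.m - 1)) x = c0" "S.free S.m z x"
    "\<And>i. i < S.m - 1 \<Longrightarrow> (f ^^ i) x \<noteq> c0"
    using S.first_hit_at_end[OF S.c1_C u] by metis
  interpret X: first_precritical T f c0 z x
    by unfold_locales (use x in auto)
  show ?thesis
  proof (cases "x = f c0")
    case True
    have "c1 \<in> left_open_arc T z c1"
      using S.seg_ends[OF S.z_facts(1) S.c1_T] S.z_facts assms(2) by (auto simp: left_open_arc_def)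
    then show ?thesis
      using X.closest_is_critical_value[OF True] Qn assms(2,3,7)
      by (intro exI[of _ c1]) (auto simp: characteristic_point_def)
  next
    case False
    obtain p where p: "p \<in> S.seg x (f c0)" "p \<noteq> x" "p \<noteq> f c0" "S.g p = p"
      "\<forall>u\<in>S.seg x p. u \<noteq> x \<longrightarrow> \<not> S.hit u"
      using X.fixed_point_exists[OF False] by blast
    note c = X.fixed_point_is_closest[OF p]
    have "p \<in> left_open_arc T z c1" using c(1) assms(2) by (auto simp: open_arc_def left_open_arc_def)
    then show ?thesis using c Qn assms(2,7) by (intro exI[of _ p]) auto
  qed
qed

end
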